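(* Let $n\ge2$ and $r\ge0$ be integers. There exists a (hereditary, pure 2-dimensional) polytopal complex $\mathcal{P}\subset\mathbb{R}^2$ whose two-dimensional faces are one triangle, $n-1$ quadrilaterals, and two further $(n+1)$-gons, such that $C^r(\widehat{\mathcal{P}})$ has a minimal generator (as a graded $\mathbb{R}[x_0,x_1,x_2]$-module) of degree $n(r+1)$ supported on a single facet. Hence $\mathrm{reg}(C^r(\widehat{\mathcal{P}}))\ge n(r+1)$; in particular, the bound $\mathrm{reg}(C^r(\widehat{\mathcal{P}}))\le (F-1)(r+1)$ conjectured for all planar hereditary polytopal complexes $\mathcal{P}$, where $F$ is the maximum number of edges of a two-dimensional face of $\mathcal{P}$, cannot be lowered further.
   Context: A polytopal complex $\mathcal{P}\subset\mathbb{R}^2$ is a finite set of convex polytopes (faces) such that every face of a member is a member and the intersection of any two members is a (possibly empty) face of both; it is pure 2-dimensional if all maximal faces (facets) have dimension 2. It is hereditary if, for every nonempty face $\gamma$, the graph whose vertices are the facets containing $\gamma$ and whose edges join facets sharing an edge is connected. The homogenization $\widehat{\mathcal{P}}\subset\mathbb{R}^3$ is the cone (join with the origin) over $\{1\}\times\mathcal{P}$; its facets are the cones $\widehat\sigma$ over facets $\sigma$ of $\mathcal{P}$. Let $S=\mathbb{R}[x_0,x_1,x_2]$. For an edge $\tau$ of $\mathcal{P}$ shared by two facets let $\ell_{\widehat\tau}\in S$ be a linear form defining the span of $\{1\}\times\tau$. $C^r(\widehat{\mathcal{P}})$ is the graded $S$-module of piecewise polynomial functions on $\widehat{\mathcal{P}}$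 continuously differentiable of order $r$, i.e. of tuples $(F_{\widehat\sigma})\in\bigoplus_{\sigma}S$ (over the facets $\sigma$ of $\mathcal{P}$) such that $\ell_{\widehat\tau}^{\,r+1}$ divides $F_{\widehat\sigma}-F_{\widehat\sigma'}$ whenever $\sigma,\sigma'$ share the edge $\tau$; its degree $d$ part consists of tuples of forms of degree $d$. A spline is supported on a single facet if it is zero on all other facets. A minimal generator is a homogeneous element not in $(x_0,x_1,x_2)C^r(\widehat{\mathcal{P}})$. $\mathrm{reg}$ denotes Castelnuovo–Mumford regularity: if $M$ has minimal graded free resolution with $F_i=\bigoplus_jS(-a_{ij})$, then $\mathrm{reg}(M)=\max_{i,j}(a_{ij}-i)$. *)

theory Defs
  imports "HOL-Analysis.Analysis" "HOL-Library.Poly_Mapping" "HOL-Library.Function_Algebras"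
    "HOL-Library.Multiset"
begin

section \<open>Planar polytopal complexes\<close>

text \<open>The empty set is a \<open>polytope\<close> and a face of every convex set, so a nonempty complex
  contains the empty face.\<close>

definition polytopal_complex :: "'a::euclidean_space set set \<Rightarrow> bool" where
  "polytopal_complex P \<longleftrightarrow>
     finite P \<and>
     (\<forall>\<sigma>\<in>P. polytope \<sigma>) \<and>
     (\<forall>\<sigma>\<in>P. \<forall>\<tau>. \<tau> face_of \<sigma> \<longrightarrow> \<tau> \<in> P) \<and>
     (\<forall>\<sigma>\<in>P. \<forall>\<tau>\<in>P. (\<sigma> \<inter> \<tau>) face_of \<sigma> \<and> (\<sigma> \<inter> \<tau>) face_of \<tau>)"

text \<open>The facets of a complex are its maximal faces (not to be confused with the
  library's \<open>facet_of\<close>, which concerns a single polytope).\<close>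

definition facets :: "'a set set \<Rightarrow> 'a set set" where
  "facets P = {\<sigma>\<in>P. \<forall>\<tau>\<in>P. \<sigma> \<subseteq> \<tau> \<longrightarrow> \<tau> = \<sigma>}"

definition pure_2dim :: "'a::euclidean_space set set \<Rightarrow> bool" where
  "pure_2dim P \<longleftrightarrow> (\<forall>\<sigma>\<in>facets P. aff_dim \<sigma> = 2)"

definition edges :: "'a::euclidean_space set \<Rightarrow> 'a set set" where
  "edges \<sigma> = {\<tau>. \<tau> face_of \<sigma> \<and> aff_dim \<tau> = 1}"

text \<open>Any two facets containing \<open>\<gamma>\<close> are joined by a path in the graph on those facets whose
  edges are the pairs of facets sharing an edge.\<close>

definition hereditary :: "'a::euclidean_space set set \<Rightarrow> bool" where
  "hereditary P \<longleftrightarrow>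
     (\<forall>\<gamma>\<in>P. \<gamma> \<noteq> {} \<longrightarrow>
       (let V = {\<sigma>\<in>facets P. \<gamma> \<subseteq> \<sigma>};
            E = {(\<sigma>, \<sigma>'). \<sigma> \<in> V \<and> \<sigma>' \<in> V \<and> \<sigma> \<noteq> \<sigma>' \<and> edges \<sigma> \<inter> edges \<sigma>' \<noteq> {}}
        in \<forall>\<sigma>\<in>V. \<forall>\<sigma>'\<in>V. (\<sigma>, \<sigma>') \<in> E\<^sup>*))"

definition two_faces :: "'a::euclidean_space set set \<Rightarrow> 'a set set" where
  "two_faces P = {\<sigma>\<in>P. aff_dim \<sigma> = 2}"

definition edge_counts :: "'a::euclidean_space set set \<Rightarrow> nat multiset" where
  "edge_counts P = image_mset (\<lambda>\<sigma>. card (edges \<sigma>)) (mset_set (two_faces P))"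

definition max_edges :: "'a::euclidean_space set set \<Rightarrow> nat" where
  "max_edges P = Max ((\<lambda>\<sigma>. card (edges \<sigma>)) ` two_faces P)"


section \<open>The graded polynomial ring in three variables\<close>

text \<open>Exponent vectors are indexed by the three-element type \<open>3\<close>, whose elements are
  \<open>0, 1, 2\<close> (in this type \<open>3 = 0\<close>).\<close>

type_synonym poly3 = "(3 \<Rightarrow>\<^sub>0 nat) \<Rightarrow>\<^sub>0 real"

definition X :: "3 \<Rightarrow> poly3" where
  "X i = Poly_Mapping.single (Poly_Mapping.single i 1) 1"

text \<open>\<open>lin_form c = c\<^sub>0 x\<^sub>0 + c\<^sub>1 x\<^sub>1 + c\<^sub>2 x\<^sub>2\<close>\<close>

definition lin_form :: "real^3 \<Rightarrow> poly3" where
  "lin_form c = (\<Sum>i\<in>UNIV. Poly_Mapping.single 0 (c $ i) * X i)"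

text \<open>Zero is homogeneous of every degree, and it is the only form of negative degree.\<close>

definition homogeneous :: "int \<Rightarrow> poly3 \<Rightarrow> bool" where
  "homogeneous d p \<longleftrightarrow>
     (\<forall>m\<in>Poly_Mapping.keys p. int (\<Sum>i\<in>UNIV. Poly_Mapping.lookup m i) = d)"


section \<open>Modules of tuples of polynomials\<close>

text \<open>Modules are sets of tuples \<open>'i \<Rightarrow> poly3\<close> with pointwise operations. A tuple has
  degree \<open>d\<close> with respect to shifts \<open>a\<close> if it lies in the degree \<open>d\<close> part of
  \<open>\<Prod>\<^sub>j S(-a\<^sub>j)\<close>.\<close>

definition smult :: "poly3 \<Rightarrow> ('i \<Rightarrow> poly3) \<Rightarrow> 'i \<Rightarrow> poly3" where
  "smult p u = (\<lambda>j. p * u j)"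

definition tuple_deg :: "('i \<Rightarrow> int) \<Rightarrow> int \<Rightarrow> ('i \<Rightarrow> poly3) \<Rightarrow> bool" where
  "tuple_deg a d u \<longleftrightarrow> (\<forall>j. homogeneous (d - a j) (u j))"

text \<open>\<open>(x\<^sub>0, x\<^sub>1, x\<^sub>2) M\<close> for a submodule \<open>M\<close>\<close>

definition irrelevant_mult :: "('i \<Rightarrow> poly3) set \<Rightarrow> ('i \<Rightarrow> poly3) set" where
  "irrelevant_mult M = {\<Sum>i\<in>UNIV. smult (X i) (G i) | G. \<forall>i. G i \<in> M}"

definition minimal_generator :: "('i \<Rightarrow> poly3) set \<Rightarrow> int \<Rightarrow> ('i \<Rightarrow> poly3) \<Rightarrow> bool" where
  "minimal_generator M d u \<longleftrightarrow>
     u \<in> M \<and> tuple_deg (\<lambda>_. 0) d u \<and> u \<notin> irrelevant_mult M"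

text \<open>The underlying module of the direct sum of the \<open>S(-a\<^sub>j)\<close> over \<open>j \<in> J\<close>; the grading is
  \<open>tuple_deg a\<close>.\<close>

definition free_mod :: "'j set \<Rightarrow> ('j \<Rightarrow> poly3) set" where
  "free_mod J = {u. finite {j. u j \<noteq> 0} \<and> {j. u j \<noteq> 0} \<subseteq> J}"

definition graded_hom ::
  "('i \<Rightarrow> poly3) set \<Rightarrow> ('i \<Rightarrow> int) \<Rightarrow> ('j \<Rightarrow> poly3) set \<Rightarrow> ('j \<Rightarrow> int)
    \<Rightarrow> (('i \<Rightarrow> poly3) \<Rightarrow> ('j \<Rightarrow> poly3)) \<Rightarrow> bool" where
  "graded_hom M a N b \<phi> \<longleftrightarrow>
     (\<forall>u\<in>M. \<phi> u \<in> N) \<and>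
     (\<forall>u\<in>M. \<forall>v\<in>M. \<phi> (u + v) = \<phi> u + \<phi> v) \<and>
     (\<forall>p. \<forall>u\<in>M. \<phi> (smult p u) = smult p (\<phi> u)) \<and>
     (\<forall>d. \<forall>u\<in>M. tuple_deg a d u \<longrightarrow> tuple_deg b d (\<phi> u))"

text \<open>A minimal graded free resolution
  \<open>\<dots> \<rightarrow> F\<^sub>2 \<rightarrow> F\<^sub>1 \<rightarrow> F\<^sub>0 \<rightarrow> M \<rightarrow> 0\<close>, where \<open>F\<^sub>i\<close> is the direct sum of the \<open>S(-a i j)\<close> over
  \<open>j \<in> J i\<close>, \<open>\<epsilon>\<close> is the augmentation \<open>F\<^sub>0 \<rightarrow> M\<close>, and \<open>\<delta> i\<close> is the map from \<open>F\<close> in position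
  \<open>Suc i\<close> to position \<open>i\<close>. The \<open>J i\<close> may be empty, so finite resolutions are included. They are
  not required to be finite: if \<open>M\<close> is finitely generated, that is automatic for a minimal
  resolution. \<open>M\<close> carries the grading by componentwise degree.\<close>

definition minimal_graded_free_resolution ::
  "('i \<Rightarrow> poly3) set \<Rightarrow> (nat \<Rightarrow> nat set) \<Rightarrow> (nat \<Rightarrow> nat \<Rightarrow> int)
    \<Rightarrow> ((nat \<Rightarrow> poly3) \<Rightarrow> ('i \<Rightarrow> poly3))
    \<Rightarrow> (nat \<Rightarrow> (nat \<Rightarrow> poly3) \<Rightarrow> (nat \<Rightarrow> poly3)) \<Rightarrow> bool" where
  "minimal_graded_free_resolution M J a \<epsilon> \<delta> \<longleftrightarrow>
     graded_hom (free_mod (J 0)) (a 0) M (\<lambda>_. 0) \<epsilon> \<and>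
     (\<forall>i. graded_hom (free_mod (J (Suc i))) (a (Suc i)) (free_mod (J i)) (a i) (\<delta> i)) \<and>
     \<epsilon> ` free_mod (J 0) = M \<and>
     {u \<in> free_mod (J 0). \<epsilon> u = 0} = \<delta> 0 ` free_mod (J 1) \<and>
     (\<forall>i. {u \<in> free_mod (J (Suc i)). \<delta> i u = 0} = \<delta> (Suc i) ` free_mod (J (Suc (Suc i)))) \<and>
     (\<forall>i. \<delta> i ` free_mod (J (Suc i)) \<subseteq> irrelevant_mult (free_mod (J i)))"

text \<open>The Castelnuovo-Mumford regularity, the largest \<open>a i j - i\<close>. The minimal resolution is
  unique up to isomorphism, so all minimal resolutions contribute the same numbers; the zero
  module has regularity \<open>-\<infinity>\<close>.\<close>

definition reg :: "('i \<Rightarrow> poly3) set \<Rightarrow> ereal" where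
  "reg M = Sup {ereal (of_int (a i j - int i)) | J a \<epsilon> \<delta> i j.
     minimal_graded_free_resolution M J a \<epsilon> \<delta> \<and> j \<in> J i}"


section \<open>Splines on the homogenization\<close>

text \<open>The point \<open>(1, p)\<close>, with coordinates indexed by \<open>0, 1, 2\<close>.\<close>

definition lift :: "real^2 \<Rightarrow> real^3" where
  "lift p = (\<chi> i. if i = 0 then 1 else if i = 1 then p $ 1 else p $ 2)"

definition defines_span :: "real^3 \<Rightarrow> (real^2) set \<Rightarrow> bool" where
  "defines_span c \<tau> \<longleftrightarrow> {v. c \<bullet> v = 0} = span (lift ` \<tau>)"

text \<open>\<open>C\<^sup>r\<close> of the homogenization of \<open>P\<close>. The facets of the homogenization are the cones over
  \<open>lift ` \<sigma>\<close> for the facets \<open>\<sigma>\<close> of \<open>P\<close>, so tuples are indexed by \<open>\<sigma>\<close>, with value \<open>0\<close>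
  at arguments that are not facets. The form defining the span of an edge is unique up to a nonzero
  scalar, so quantifying over all such forms is harmless.\<close>

definition splines :: "nat \<Rightarrow> (real^2) set set \<Rightarrow> ((real^2) set \<Rightarrow> poly3) set" where
  "splines r P = {F.
     (\<forall>\<sigma>. \<sigma> \<notin> facets P \<longrightarrow> F \<sigma> = 0) \<and>
     (\<forall>\<sigma>\<in>facets P. \<forall>\<sigma>'\<in>facets P. \<sigma> \<noteq> \<sigma>' \<longrightarrow>
        (\<forall>\<tau>\<in>edges \<sigma> \<inter> edges \<sigma>'. \<forall>c. defines_span c \<tau> \<longrightarrow>
           lin_form c ^ (r + 1) dvd F \<sigma> - F \<sigma>'))}"

definition supported_on_single_facet ::
  "(real^2) set set \<Rightarrow> ((real^2) set \<Rightarrow> poly3) \<Rightarrow> bool" where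
  "supported_on_single_facet P F \<longleftrightarrow>
     (\<exists>\<sigma>\<in>facets P. \<forall>\<sigma>'\<in>facets P. \<sigma>' \<noteq> \<sigma> \<longrightarrow> F \<sigma>' = 0)"

end

theory Submission
  imports Defs
begin

text \<open>
  The complexes \<open>P\<close> are mirror symmetric about the axis \<open>x = 0\<close>. The points \<open>(i\<^sup>2, i)\<close>, \<open>0 \<le> i \<le> n\<close>,
  lie on a parabola, so their convex hull is an \<open>(n + 1)\<close>-gon (the right wing); its mirror image is
  the left wing. The region between the wings is cut by the horizontal lines \<open>y = i\<close> into a triangle
  and \<open>n - 1\<close> trapezoids. The \<open>m\<close>-th of these strips meets the right wing along an edge with form
  \<open>\<ell>\<^sub>m\<close> and the left wing along the mirrored edge, with form \<open>\<ell>'\<^sub>m\<close>. The spline \<open>F\<close> that is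
  \<open>\<Prod>\<^sub>m \<ell>\<^sub>m\<^sup>r\<^sup>+\<^sup>1\<close> on the right wing and zero elsewhere has degree \<open>n (r + 1)\<close>.

  It is a minimal generator for the following reason. For any spline \<open>G\<close>, going from one wing to the
  other through the \<open>m\<close>-th strip shows that the difference \<open>\<Lambda> G\<close> of the values of \<open>G\<close> on the two
  wings lies in the ideal generated by \<open>\<ell>\<^sub>m\<^sup>r\<^sup>+\<^sup>1\<close> and \<open>\<ell>'\<^sub>m\<^sup>r\<^sup>+\<^sup>1\<close>. By symmetry \<open>\<ell>\<^sub>m\<close> and \<open>\<ell>'\<^sub>m\<close>
  are proportional on the axis, so the restriction of \<open>\<Lambda> G\<close> to the axis is divisible by the
  \<open>(r + 1)\<close>-st powers of \<open>n\<close> pairwise coprime linear forms. Hence it vanishes if \<open>G\<close> has degree less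
  than \<open>n (r + 1)\<close>, and then the restriction of \<open>\<Lambda>\<close> vanishes in degree \<open>n (r + 1)\<close> on
  \<open>(x\<^sub>0, x\<^sub>1, x\<^sub>2) C\<^sup>r\<close> as well; but it does not vanish on \<open>F\<close>
  (\<open>minimal_generator_if_restr\<close>, \<open>wing_minimal_generator\<close>).

  For \<open>n \<ge> 3\<close> the largest number of edges of a face of \<open>P\<close> is \<open>n + 1\<close>, which gives the sharpness of
  the bound for faces with at least four edges. For \<open>n = 2\<close> it is \<open>4\<close>, because of the trapezoid, so the case of three
  edges needs another complex: a square cut by its diagonals. There the alternating sum of the four
  values of a spline is divisible by the \<open>(r + 1)\<close>-st powers of the forms of both diagonals, and the
  same argument applies on a line that misses the centre (\<open>square_minimal_generator\<close>).

  Bounding the regularity from below requires that a minimal resolution exists, since the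
  regularity is a supremum over all of them. Every graded submodule of a graded free module of
  countable rank with degrees bounded below has a minimal homogeneous generating set, obtained degree
  by degree from linear algebra (\<open>exists_minimal_generating_family\<close>); iterating this on the modules of
  relations gives the resolution (\<open>exists_minimal_resolution\<close>). A generator of degree \<open>D\<close> in the
  first step contributes \<open>D\<close> to the regularity (\<open>minimal_generator_imp_reg_ge\<close>).
\<close>

section \<open>Homogeneous components of polynomials\<close>

text \<open>The total degree of an exponent vector.\<close>

definition mdeg :: "(3 \<Rightarrow>\<^sub>0 nat) \<Rightarrow> int" where
  "mdeg m = int (\<Sum>i\<in>UNIV. Poly_Mapping.lookup m i)"

lemma mdeg_add: "mdeg (m + m') = mdeg m + mdeg m'"
  by (simp add: mdeg_def lookup_add sum.distrib)

lemma mdeg_zero [simp]: "mdeg 0 = 0"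
  by (simp add: mdeg_def)

lemma mdeg_nonneg [simp]: "0 \<le> mdeg m"
  unfolding mdeg_def by (rule of_nat_0_le_iff)

lemma mdeg_eq_0_iff: "mdeg m = 0 \<longleftrightarrow> m = 0"
proof
  assume "mdeg m = 0"
  then have "(\<Sum>i\<in>UNIV. Poly_Mapping.lookup m i) = 0"
    unfolding mdeg_def by (simp only: of_nat_eq_0_iff)
  then have "\<forall>i. Poly_Mapping.lookup m i = 0" by simp
  then show "m = 0" by (simp add: poly_mapping_eqI)
qed simp

lemma homogeneous_iff: "homogeneous d p \<longleftrightarrow> (\<forall>m. Poly_Mapping.lookup p m \<noteq> 0 \<longrightarrow> mdeg m = d)"
  by (auto simp: homogeneous_def mdeg_def in_keys_iff)

lemma poly3_sum_single:
  fixes p :: poly3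
  shows "p = (\<Sum>m\<in>Poly_Mapping.keys p. Poly_Mapping.single m (Poly_Mapping.lookup p m))"
  by (rule poly_mapping_eqI)
     (simp add: lookup_sum lookup_single when_def in_keys_iff sum.delta)

lemma poly3_additive_induct [case_names single add]:
  fixes p :: poly3
  assumes single: "\<And>m c. Q (Poly_Mapping.single m c)"
    and add: "\<And>p q. Q p \<Longrightarrow> Q q \<Longrightarrow> Q (p + q)"
  shows "Q p"
proof -
  have "Q (\<Sum>m\<in>A. Poly_Mapping.single m (Poly_Mapping.lookup p m))" if "finite A" for A
    using that
  proof induction
    case empty
    show ?case using single[of 0 0] by simp
  next
    case (insert x F)
    then show ?case by (simp add: single add)
  qed
  from this[of "Poly_Mapping.keys p"] show ?thesis
    using poly3_sum_single[of p] by simp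
qed

lemma homogeneous_0 [simp]: "homogeneous d 0"
  by (simp add: homogeneous_iff)

lemma homogeneous_single: "homogeneous (mdeg m) (Poly_Mapping.single m c)"
  by (auto simp: homogeneous_iff lookup_single when_def split: if_splits)

lemma homogeneous_add: "homogeneous d p \<Longrightarrow> homogeneous d q \<Longrightarrow> homogeneous d (p + q)"
  unfolding homogeneous_iff
proof (intro allI impI)
  fix m
  assume h: "\<forall>m. Poly_Mapping.lookup p m \<noteq> 0 \<longrightarrow> mdeg m = d"
    "\<forall>m. Poly_Mapping.lookup q m \<noteq> 0 \<longrightarrow> mdeg m = d"
    and "Poly_Mapping.lookup (p + q) m \<noteq> 0"
  then have "Poly_Mapping.lookup p m \<noteq> 0 \<or> Poly_Mapping.lookup q m \<noteq> 0"
    by (auto simp: lookup_add)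
  then show "mdeg m = d" using h by blast
qed

lemma homogeneous_uminus: "homogeneous d p \<Longrightarrow> homogeneous d (- p)"
  by (simp add: homogeneous_iff)

lemma homogeneous_diff: "homogeneous d p \<Longrightarrow> homogeneous d q \<Longrightarrow> homogeneous d (p - q)"
  using homogeneous_add[of d p "- q"] homogeneous_uminus[of d q] by simp

lemma homogeneous_sum: "(\<And>x. x \<in> A \<Longrightarrow> homogeneous d (f x)) \<Longrightarrow> homogeneous d (sum f A)"
  by (induction A rule: infinite_finite_induct) (auto intro: homogeneous_add)

lemma homogeneous_mult:
  assumes "homogeneous d p" "homogeneous e q"
  shows "homogeneous (d + e) (p * q)"
  unfolding homogeneous_iff
proof (intro allI impI)
  fix m assume "Poly_Mapping.lookup (p * q) m \<noteq> 0"
  then have "m \<in> Poly_Mapping.keys (p * q)" by (simp add: in_keys_iff)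
  then obtain a b where "m = a + b" "a \<in> Poly_Mapping.keys p" "b \<in> Poly_Mapping.keys q"
    using keys_mult[of p q] by auto
  then show "mdeg m = d + e"
    using assms by (auto simp: homogeneous_iff in_keys_iff mdeg_add)
qed

lemma homogeneous_1: "homogeneous 0 1"
  by (simp add: homogeneous_iff lookup_one when_def)

lemma homogeneous_power: "homogeneous d p \<Longrightarrow> homogeneous (int n * d) (p ^ n)"
proof (induction n)
  case (Suc n)
  then show ?case using homogeneous_mult[of d p "int n * d" "p ^ n"]
    by (simp add: algebra_simps)
qed (simp add: homogeneous_1)

lemma homogeneous_prod:
  "(\<And>i. i \<in> A \<Longrightarrow> homogeneous d (f i)) \<Longrightarrow> homogeneous (int (card A) * d) (prod f A)"
proof (induction A rule: infinite_finite_induct)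
  case (insert x F)
  then show ?case using homogeneous_mult[of d "f x" "int (card F) * d" "prod f F"]
    by (simp add: algebra_simps)
qed (simp_all add: homogeneous_1)

lemma homogeneous_neg: "homogeneous d p \<Longrightarrow> d < 0 \<Longrightarrow> p = 0"
  using mdeg_nonneg by (intro poly_mapping_eqI) (force simp: homogeneous_iff not_less[symmetric])

lemma homogeneous_const: "homogeneous 0 (Poly_Mapping.single 0 c)"
  using homogeneous_single[of 0 c] by simp

lemma homogeneous_X: "homogeneous 1 (X i)"
proof -
  have "mdeg (Poly_Mapping.single i 1) = 1"
    by (simp add: mdeg_def lookup_single when_def)
  then show ?thesis using homogeneous_single[of "Poly_Mapping.single i 1" 1]
    by (simp add: X_def)
qed

lemma homogeneous_lin_form: "homogeneous 1 (lin_form c)"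
  unfolding lin_form_def
proof (rule homogeneous_sum)
  fix i show "homogeneous 1 (Poly_Mapping.single 0 (c $ i) * X i)"
    using homogeneous_mult[OF homogeneous_const homogeneous_X] by simp
qed

text \<open>The degree \<open>d\<close> part of a polynomial.\<close>

definition hcomp :: "int \<Rightarrow> poly3 \<Rightarrow> poly3" where
  "hcomp d p = Poly_Mapping.mapp (\<lambda>m c. if mdeg m = d then c else 0) p"

lemma lookup_hcomp: "Poly_Mapping.lookup (hcomp d p) m = (if mdeg m = d then Poly_Mapping.lookup p m else 0)"
  by (auto simp: hcomp_def lookup_mapp when_def in_keys_iff)

lemma homogeneous_hcomp: "homogeneous d (hcomp d p)"
  by (auto simp: homogeneous_iff lookup_hcomp)

lemma hcomp_add: "hcomp d (p + q) = hcomp d p + hcomp d q"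
  by (rule poly_mapping_eqI) (simp add: lookup_hcomp lookup_add)

lemma hcomp_diff: "hcomp d (p - q) = hcomp d p - hcomp d q"
  by (rule poly_mapping_eqI) (simp add: lookup_hcomp lookup_minus)

lemma hcomp_0 [simp]: "hcomp d 0 = 0"
  by (rule poly_mapping_eqI) (simp add: lookup_hcomp)

lemma hcomp_sum: "hcomp d (sum f A) = (\<Sum>x\<in>A. hcomp d (f x))"
  by (induction A rule: infinite_finite_induct) (auto simp: hcomp_add)

lemma hcomp_homogeneous: "homogeneous e p \<Longrightarrow> hcomp d p = (if d = e then p else 0)"
  by (rule poly_mapping_eqI) (auto simp: lookup_hcomp homogeneous_iff)

lemma hcomp_mult:
  assumes "homogeneous e q"
  shows "hcomp d (q * p) = q * hcomp (d - e) p"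
proof (induction p rule: poly3_additive_induct)
  case (single m c)
  have "homogeneous (e + mdeg m) (q * Poly_Mapping.single m c)"
    by (rule homogeneous_mult[OF assms homogeneous_single])
  from hcomp_homogeneous[OF this, of d] hcomp_homogeneous[OF homogeneous_single, of "d - e" m c]
  show ?case by (auto split: if_splits)
next
  case (add p q')
  then show ?case by (simp add: hcomp_add algebra_simps)
qed

lemma sum_hcomp:
  assumes "finite D" "mdeg ` Poly_Mapping.keys p \<subseteq> D"
  shows "p = (\<Sum>d\<in>D. hcomp d p)"
proof (rule poly_mapping_eqI)
  fix m
  have "(\<Sum>d\<in>D. Poly_Mapping.lookup (hcomp d p) m) = (if mdeg m \<in> D then Poly_Mapping.lookup p m else 0)"
    using assms(1) by (simp add: lookup_hcomp sum.delta)
  also have "\<dots> = Poly_Mapping.lookup p m"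
  proof -
    have "mdeg m \<in> D" if "Poly_Mapping.lookup p m \<noteq> 0"
      using assms(2) that by (force simp: in_keys_iff)
    then show ?thesis by auto
  qed
  finally show "Poly_Mapping.lookup p m = Poly_Mapping.lookup (\<Sum>d\<in>D. hcomp d p) m"
    by (simp add: lookup_sum)
qed

lemma dvd_hcomp: "homogeneous e q \<Longrightarrow> q dvd p \<Longrightarrow> q dvd hcomp d p"
  by (auto simp: dvd_def hcomp_mult)

lemma hcomp_eq_const: "hcomp 0 p = Poly_Mapping.single 0 (Poly_Mapping.lookup p 0)"
  by (rule poly_mapping_eqI) (auto simp: lookup_hcomp lookup_single when_def mdeg_eq_0_iff)

lemma hcomp_self: "homogeneous d p \<Longrightarrow> hcomp d p = p"
  by (simp add: hcomp_homogeneous)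

text \<open>Polynomials without constant term lie in the ideal generated by the variables.\<close>

lemma no_constant_term_imp:
  assumes "Poly_Mapping.lookup p 0 = 0"
  shows "\<exists>q. p = (\<Sum>i\<in>UNIV. X i * q i)"
proof -
  have single: "\<exists>q. Poly_Mapping.single m c = (\<Sum>i\<in>UNIV. X i * q i)" if "m \<noteq> 0" for m and c :: real
  proof -
    obtain i where i: "Poly_Mapping.lookup m i \<noteq> 0"
      using \<open>m \<noteq> 0\<close> by (metis lookup_zero poly_mapping_eqI)
    let ?m = "m - Poly_Mapping.single i 1"
    have "Poly_Mapping.single i 1 + ?m = m"
      using i by (intro poly_mapping_eqI) (auto simp: lookup_add lookup_minus lookup_single when_def)
    then have e: "Poly_Mapping.single m c = X i * Poly_Mapping.single ?m c"
      by (simp add: X_def mult_single)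
    have "(\<Sum>k\<in>UNIV. X k * (if k = i then Poly_Mapping.single ?m c else 0))
        = (\<Sum>k\<in>UNIV. (if k = i then X k * Poly_Mapping.single ?m c else 0))"
      by (rule sum.cong) auto
    also have "\<dots> = Poly_Mapping.single m c" by (simp only: sum.delta finite_class.finite UNIV_I if_True e)
    finally show ?thesis
      by (intro exI[of _ "\<lambda>k. if k = i then Poly_Mapping.single ?m c else 0"]) simp
  qed
  have "\<exists>q. (\<Sum>m\<in>A. Poly_Mapping.single m (Poly_Mapping.lookup p m)) = (\<Sum>i\<in>UNIV. X i * q i)"
    if "finite A" "0 \<notin> A" for A
    using that
  proof induction
    case empty
    show ?case by (intro exI[of _ "\<lambda>_. 0"]) simp
  next
    case (insert m A)
    obtain q where q: "(\<Sum>m\<in>A. Poly_Mapping.single m (Poly_Mapping.lookup p m)) = (\<Sum>i\<in>UNIV. X i * q i)"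
      using insert by auto
    obtain q' where q': "Poly_Mapping.single m (Poly_Mapping.lookup p m) = (\<Sum>i\<in>UNIV. X i * q' i)"
      using single insert.prems by auto
    show ?case using insert.hyps q q'
      by (intro exI[of _ "\<lambda>i. q' i + q i"]) (simp add: algebra_simps sum.distrib)
  qed
  from this[of "Poly_Mapping.keys p"] show ?thesis
    using poly3_sum_single[of p] assms by (simp add: in_keys_iff)
qed

section \<open>Graded modules of tuples\<close>

lemma sum_fun_apply: "sum f A j = (\<Sum>x\<in>A. f x j)"
  by (induction A rule: infinite_finite_induct) auto

lemma smult_apply [simp]: "smult p u j = p * u j"
  by (simp add: smult_def)

lemma smult_add_right: "smult p (u + v) = smult p u + smult p v"
  by (rule ext) (simp add: algebra_simps)

lemma smult_add_left: "smult (p + q) u = smult p u + smult q u"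
  by (rule ext) (simp add: algebra_simps)

lemma smult_smult: "smult p (smult q u) = smult (p * q) u"
  by (rule ext) (simp add: algebra_simps)

lemma smult_sum_right: "smult p (sum f A) = (\<Sum>x\<in>A. smult p (f x))"
  by (rule ext) (simp add: sum_fun_apply sum_distrib_left)

lemma smult_sum_left: "smult (sum f A) u = (\<Sum>x\<in>A. smult (f x) u)"
  by (rule ext) (simp add: sum_fun_apply sum_distrib_right)

lemma smult_0 [simp]: "smult 0 u = 0" "smult p 0 = 0"
  by (rule ext, simp)+

lemma smult_1 [simp]: "smult 1 u = u"
  by (rule ext) simp

text \<open>The degree \<open>d\<close> part of a tuple with respect to the shifts \<open>a\<close>.\<close>

definition tcomp :: "('i \<Rightarrow> int) \<Rightarrow> int \<Rightarrow> ('i \<Rightarrow> poly3) \<Rightarrow> 'i \<Rightarrow> poly3" where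
  "tcomp a d u = (\<lambda>j. hcomp (d - a j) (u j))"

lemma tcomp_apply: "tcomp a d u j = hcomp (d - a j) (u j)"
  by (simp add: tcomp_def)

lemma tuple_deg_tcomp: "tuple_deg a d (tcomp a d u)"
  by (simp add: tuple_deg_def tcomp_def homogeneous_hcomp)

lemma tcomp_0 [simp]: "tcomp a d 0 = 0"
  by (rule ext) (simp add: tcomp_def)

lemma tcomp_sum: "tcomp a d (sum f A) = (\<Sum>x\<in>A. tcomp a d (f x))"
  by (rule ext) (simp add: tcomp_def sum_fun_apply hcomp_sum)

lemma tcomp_tuple_deg: "tuple_deg a d u \<Longrightarrow> tcomp a d u = u"
  by (rule ext) (simp add: tcomp_def tuple_deg_def hcomp_self)

lemma tcomp_smult_homogeneous:
  "homogeneous e p \<Longrightarrow> tcomp a d (smult p u) = smult p (tcomp a (d - e) u)"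
  by (rule ext) (simp add: tcomp_def hcomp_mult algebra_simps)

lemma tcomp_smult_tuple_deg:
  assumes "tuple_deg a e u"
  shows "tcomp a d (smult p u) = smult (hcomp (d - e) p) u"
proof (rule ext)
  fix j
  have "homogeneous (e - a j) (u j)" using assms by (simp add: tuple_deg_def)
  from hcomp_mult[OF this, of "d - a j" p]
  show "tcomp a d (smult p u) j = smult (hcomp (d - e) p) u j"
    by (simp add: tcomp_def mult.commute)
qed

lemma tuple_deg_0 [simp]: "tuple_deg a d 0"
  by (simp add: tuple_deg_def)

lemma tuple_deg_add: "tuple_deg a d u \<Longrightarrow> tuple_deg a d v \<Longrightarrow> tuple_deg a d (u + v)"
  by (simp add: tuple_deg_def homogeneous_add)

lemma tuple_deg_sum: "(\<And>x. x \<in> A \<Longrightarrow> tuple_deg a d (f x)) \<Longrightarrow> tuple_deg a d (sum f A)"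
  by (induction A rule: infinite_finite_induct) (auto intro: tuple_deg_add)

lemma tuple_deg_smult:
  assumes "homogeneous e p" "tuple_deg a d u"
  shows "tuple_deg a (e + d) (smult p u)"
  unfolding tuple_deg_def
proof
  fix j
  show "homogeneous (e + d - a j) (smult p u j)"
    using homogeneous_mult[OF assms(1), of "d - a j" "u j"] assms(2)
    by (simp add: tuple_deg_def algebra_simps)
qed

lemma tuple_deg_const: "tuple_deg a d u \<Longrightarrow> tuple_deg a d (smult (Poly_Mapping.single 0 c) u)"
  using tuple_deg_smult[OF homogeneous_const] by force

text \<open>Submodules are graded if they contain the homogeneous components of their elements.\<close>

definition graded_submodule :: "('i \<Rightarrow> int) \<Rightarrow> ('i \<Rightarrow> poly3) set \<Rightarrow> bool" where
  "graded_submodule a N \<longleftrightarrow> 0 \<in> N \<and> (\<forall>u\<in>N. \<forall>v\<in>N. u + v \<in> N) \<and> (\<forall>p. \<forall>u\<in>N. smult p u \<in> N) \<and>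
     (\<forall>d. \<forall>u\<in>N. tcomp a d u \<in> N)"

lemma graded_submoduleD:
  assumes "graded_submodule a N"
  shows "0 \<in> N" "u \<in> N \<Longrightarrow> v \<in> N \<Longrightarrow> u + v \<in> N" "u \<in> N \<Longrightarrow> smult p u \<in> N" "u \<in> N \<Longrightarrow> tcomp a d u \<in> N"
  using assms by (auto simp: graded_submodule_def)

lemma graded_submodule_sum:
  assumes "graded_submodule a N"
  shows "(\<And>x. x \<in> A \<Longrightarrow> f x \<in> N) \<Longrightarrow> sum f A \<in> N"
  by (induction A rule: infinite_finite_induct) (auto intro: graded_submoduleD[OF assms])

lemma irrelevant_mult_iff: "u \<in> irrelevant_mult M \<longleftrightarrow> (\<exists>G. (\<forall>i. G i \<in> M) \<and> u = (\<Sum>i\<in>UNIV. smult (X i) (G i)))"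
  by (auto simp: irrelevant_mult_def)

lemma irrelevant_multI: "(\<And>i. G i \<in> M) \<Longrightarrow> u = (\<Sum>i\<in>UNIV. smult (X i) (G i)) \<Longrightarrow> u \<in> irrelevant_mult M"
  unfolding irrelevant_mult_iff by (intro exI conjI allI)

lemma irrelevant_mult_add:
  assumes "graded_submodule a N" "u \<in> irrelevant_mult N" "v \<in> irrelevant_mult N"
  shows "u + v \<in> irrelevant_mult N"
proof -
  from assms obtain G H where "\<forall>i. G i \<in> N" "u = (\<Sum>i\<in>UNIV. smult (X i) (G i))"
    "\<forall>i. H i \<in> N" "v = (\<Sum>i\<in>UNIV. smult (X i) (H i))"
    by (auto simp: irrelevant_mult_iff)
  then show ?thesis unfolding irrelevant_mult_iff
    by (intro exI[of _ "\<lambda>i. G i + H i"])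
       (auto simp: smult_add_right sum.distrib intro: graded_submoduleD[OF assms(1)])
qed

lemma irrelevant_mult_0:
  assumes "graded_submodule a N"
  shows "0 \<in> irrelevant_mult N"
  unfolding irrelevant_mult_iff
  by (intro exI[of _ "\<lambda>_. 0"]) (simp add: graded_submoduleD[OF assms])

lemma irrelevant_mult_smult:
  assumes "graded_submodule a N" "u \<in> irrelevant_mult N"
  shows "smult p u \<in> irrelevant_mult N"
proof -
  from assms obtain G where G: "\<forall>i. G i \<in> N" "u = (\<Sum>i\<in>UNIV. smult (X i) (G i))"
    by (auto simp: irrelevant_mult_iff)
  have "smult p u = (\<Sum>i\<in>UNIV. smult (X i) (smult p (G i)))"
    unfolding G(2) smult_sum_right smult_smult by (simp only: mult.commute)
  moreover have "smult p (G i) \<in> N" for i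
    using G(1) graded_submoduleD(3)[OF assms(1)] by simp
  ultimately show ?thesis by (rule irrelevant_multI[rotated])
qed

lemma irrelevant_mult_sum:
  assumes "graded_submodule a N"
  shows "(\<And>x. x \<in> A \<Longrightarrow> f x \<in> irrelevant_mult N) \<Longrightarrow> sum f A \<in> irrelevant_mult N"
  by (induction A rule: infinite_finite_induct)
     (auto intro: irrelevant_mult_add[OF assms] irrelevant_mult_0[OF assms])

lemma smult_in_irrelevant_mult:
  assumes "graded_submodule a N" "u \<in> N" "Poly_Mapping.lookup p 0 = 0"
  shows "smult p u \<in> irrelevant_mult N"
proof -
  obtain q where q: "p = (\<Sum>i\<in>UNIV. X i * q i)" using no_constant_term_imp assms(3) by blast
  have "smult p u = (\<Sum>i\<in>UNIV. smult (X i) (smult (q i) u))"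
    unfolding q smult_sum_left smult_smult ..
  moreover have "smult (q i) u \<in> N" for i
    using assms(2) graded_submoduleD(3)[OF assms(1)] by simp
  ultimately show ?thesis by (rule irrelevant_multI[rotated])
qed

lemma irrelevant_mult_tuple_deg:
  assumes "graded_submodule a N" "u \<in> irrelevant_mult N" "tuple_deg a d u"
  obtains G where "\<And>i. G i \<in> N" "\<And>i. tuple_deg a (d - 1) (G i)" "u = (\<Sum>i\<in>UNIV. smult (X i) (G i))"
proof -
  from assms obtain G where G: "\<forall>i. G i \<in> N" "u = (\<Sum>i\<in>UNIV. smult (X i) (G i))"
    by (auto simp: irrelevant_mult_iff)
  have "u = tcomp a d u" using assms(3) by (simp add: tcomp_tuple_deg)
  also have "\<dots> = (\<Sum>i\<in>UNIV. smult (X i) (tcomp a (d - 1) (G i)))"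
    unfolding G(2) tcomp_sum by (simp add: tcomp_smult_homogeneous[OF homogeneous_X])
  finally show ?thesis
    by (rule that[rotated 2]) (simp_all add: G(1) graded_submoduleD(4)[OF assms(1)] tuple_deg_tcomp)
qed

text \<open>Tuples form a real vector space, the scalars being the constant polynomials.\<close>

interpretation tuple_space: vector_space "\<lambda>c::real. smult (Poly_Mapping.single 0 c) :: ('i \<Rightarrow> poly3) \<Rightarrow> _"
  by unfold_locales
     (simp_all add: smult_add_right smult_add_left smult_smult single_add mult_single)

section \<open>Minimal graded free resolutions\<close>

lemma three_eq_0: "(3::3) = 0"
  by simp

lemma lookup3_inj: "inj (\<lambda>m :: 3 \<Rightarrow>\<^sub>0 nat. (Poly_Mapping.lookup m 0, Poly_Mapping.lookup m 1, Poly_Mapping.lookup m 2))"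
proof (rule injI)
  fix m m' :: "3 \<Rightarrow>\<^sub>0 nat"
  assume "(Poly_Mapping.lookup m 0, Poly_Mapping.lookup m 1, Poly_Mapping.lookup m 2)
        = (Poly_Mapping.lookup m' 0, Poly_Mapping.lookup m' 1, Poly_Mapping.lookup m' 2)"
  then have "Poly_Mapping.lookup m i = Poly_Mapping.lookup m' i" for i
    using exhaust_3[of i] by (auto simp: three_eq_0)
  then show "m = m'" by (intro poly_mapping_eqI)
qed

text \<open>The monomial \<open>m\<close> in position \<open>j\<close>; these tuples span a free module as a real vector space.\<close>

definition unit_tuple :: "'i \<Rightarrow> (3 \<Rightarrow>\<^sub>0 nat) \<Rightarrow> 'i \<Rightarrow> poly3" where
  "unit_tuple j m = (\<lambda>k. if k = j then Poly_Mapping.single m 1 else 0)"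

lemma free_mod_span:
  assumes "u \<in> free_mod I"
  shows "u \<in> tuple_space.span (case_prod unit_tuple ` (I \<times> UNIV))"
proof -
  let ?A = "{j. u j \<noteq> 0}"
  have fin: "finite ?A" and sub: "?A \<subseteq> I" using assms by (auto simp: free_mod_def)
  have "u = (\<Sum>j\<in>?A. \<Sum>m\<in>Poly_Mapping.keys (u j).
      smult (Poly_Mapping.single 0 (Poly_Mapping.lookup (u j) m)) (unit_tuple j m))" (is "u = ?R")
  proof (rule ext)
    fix k
    have "?R k = (\<Sum>j\<in>?A. if k = j then (\<Sum>m\<in>Poly_Mapping.keys (u j).
        Poly_Mapping.single m (Poly_Mapping.lookup (u j) m)) else 0)"
      unfolding sum_fun_apply by (intro sum.cong) (auto simp: unit_tuple_def mult_single)
    also have "\<dots> = (\<Sum>j\<in>?A. if k = j then u j else 0)"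
      using poly3_sum_single by (intro sum.cong) auto
    also have "\<dots> = u k" using fin by (simp add: sum.delta)
    finally show "u k = ?R k" by simp
  qed
  moreover have "?R \<in> tuple_space.span (case_prod unit_tuple ` (I \<times> UNIV))"
    using sub by (intro tuple_space.span_sum tuple_space.span_scale tuple_space.span_base) force
  ultimately show ?thesis by simp
qed

lemma (in vector_space) countable_independent:
  assumes "countable W" "independent B" "B \<subseteq> span W"
  shows "countable B"
proof -
  let ?F = "{F. finite F \<and> F \<subseteq> W}"
  have "B \<subseteq> (\<Union>F\<in>?F. B \<inter> span F)"
  proof
    fix b assume "b \<in> B"
    then have "b \<in> span W" using assms(3) by auto
    then obtain t r where t: "finite t" "t \<subseteq> W" "b = (\<Sum>a\<in>t. scale (r a) a)"
      by (auto simp: span_explicit)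
    have "b \<in> span t" unfolding t(3) by (intro span_sum span_scale span_base)
    then show "b \<in> (\<Union>F\<in>?F. B \<inter> span F)" using t \<open>b \<in> B\<close> by auto
  qed
  moreover have "countable (\<Union>F\<in>?F. B \<inter> span F)"
  proof (rule countable_UN)
    show "countable ?F" using assms(1) by (rule countable_Collect_finite_subset)
    fix F assume "F \<in> ?F"
    moreover have "independent (B \<inter> span F)"
      using assms(2) by (rule independent_mono) auto
    ultimately show "countable (B \<inter> span F)"
      using independent_span_bound[of F "B \<inter> span F"] by (auto intro: countable_finite)
  qed
  ultimately show ?thesis by (rule countable_subset)
qed

lemma countable_independent_tuples:
  assumes "countable I" "B \<subseteq> free_mod I" "tuple_space.independent B"
  shows "countable B"
proof (rule tuple_space.countable_independent[OF _ assms(3)])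
  have "countable (UNIV :: (3 \<Rightarrow>\<^sub>0 nat) set)"
    by (rule countable_image_inj_on[OF countableI_type lookup3_inj])
  then show "countable (case_prod unit_tuple ` (I \<times> UNIV))"
    using assms(1) by (intro countable_image countable_SIGMA) auto
  show "B \<subseteq> tuple_space.span (case_prod unit_tuple ` (I \<times> UNIV))"
    using assms(2) free_mod_span by blast
qed

text \<open>The homomorphism from a free module that sends the \<open>j\<close>-th basis vector to \<open>g j\<close>.\<close>

definition lincomb :: "('j \<Rightarrow> 'i \<Rightarrow> poly3) \<Rightarrow> ('j \<Rightarrow> poly3) \<Rightarrow> 'i \<Rightarrow> poly3" where
  "lincomb g u = (\<Sum>j | u j \<noteq> 0. smult (u j) (g j))"

lemma lincomb_eq_sum:
  assumes "finite A" "{j. u j \<noteq> 0} \<subseteq> A"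
  shows "lincomb g u = (\<Sum>j\<in>A. smult (u j) (g j))"
  unfolding lincomb_def using assms by (intro sum.mono_neutral_left) auto

lemma free_modD: "u \<in> free_mod J \<Longrightarrow> finite {j. u j \<noteq> 0}" "u \<in> free_mod J \<Longrightarrow> {j. u j \<noteq> 0} \<subseteq> J"
  by (auto simp: free_mod_def)

lemma free_mod_0 [simp]: "0 \<in> free_mod J"
  by (simp add: free_mod_def)

lemma free_mod_mono: "{j. v j \<noteq> 0} \<subseteq> {j. u j \<noteq> 0} \<Longrightarrow> u \<in> free_mod J \<Longrightarrow> v \<in> free_mod J"
  by (auto simp: free_mod_def intro: finite_subset)

lemma free_mod_add: "u \<in> free_mod J \<Longrightarrow> v \<in> free_mod J \<Longrightarrow> u + v \<in> free_mod J"
proof -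
  assume u: "u \<in> free_mod J" and v: "v \<in> free_mod J"
  have "{j. (u + v) j \<noteq> 0} \<subseteq> {j. u j \<noteq> 0} \<union> {j. v j \<noteq> 0}" by auto
  then show ?thesis using u v by (auto simp: free_mod_def intro: finite_subset)
qed

lemma free_mod_smult: "u \<in> free_mod J \<Longrightarrow> smult p u \<in> free_mod J"
  by (rule free_mod_mono[of _ u]) auto

lemma free_mod_tcomp: "u \<in> free_mod J \<Longrightarrow> tcomp a d u \<in> free_mod J"
  by (rule free_mod_mono[of _ u]) (auto simp: tcomp_def)

lemma graded_submodule_free_mod: "graded_submodule a (free_mod J)"
  by (simp add: graded_submodule_def free_mod_add free_mod_smult free_mod_tcomp)

lemma lincomb_0 [simp]: "lincomb g 0 = 0"
  by (simp add: lincomb_def)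

lemma lincomb_add:
  assumes "u \<in> free_mod J" "v \<in> free_mod J"
  shows "lincomb g (u + v) = lincomb g u + lincomb g v"
proof -
  let ?A = "{j. u j \<noteq> 0} \<union> {j. v j \<noteq> 0}"
  have A: "finite ?A" using assms free_modD by auto
  have "lincomb g (u + v) = (\<Sum>j\<in>?A. smult ((u + v) j) (g j))"
    using A by (rule lincomb_eq_sum) auto
  moreover have "lincomb g u = (\<Sum>j\<in>?A. smult (u j) (g j))"
    using A by (rule lincomb_eq_sum) auto
  moreover have "lincomb g v = (\<Sum>j\<in>?A. smult (v j) (g j))"
    using A by (rule lincomb_eq_sum) auto
  ultimately show ?thesis by (simp add: smult_add_left sum.distrib)
qed

lemma lincomb_smult:
  assumes "u \<in> free_mod J"
  shows "lincomb g (smult p u) = smult p (lincomb g u)"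
proof -
  let ?A = "{j. u j \<noteq> 0}"
  have A: "finite ?A" using assms free_modD by auto
  have "lincomb g (smult p u) = (\<Sum>j\<in>?A. smult (smult p u j) (g j))"
    using A by (rule lincomb_eq_sum) auto
  then show ?thesis by (simp add: lincomb_def smult_sum_right smult_smult)
qed

lemma lincomb_tcomp:
  assumes "u \<in> free_mod J" "\<And>j. j \<in> J \<Longrightarrow> tuple_deg b (a j) (g j)"
  shows "lincomb g (tcomp a d u) = tcomp b d (lincomb g u)"
proof -
  let ?A = "{j. u j \<noteq> 0}"
  have A: "finite ?A" using assms free_modD by auto
  have "lincomb g (tcomp a d u) = (\<Sum>j\<in>?A. smult (tcomp a d u j) (g j))"
    using A by (rule lincomb_eq_sum) (auto simp: tcomp_def)
  also have "\<dots> = (\<Sum>j\<in>?A. tcomp b d (smult (u j) (g j)))"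
  proof (rule sum.cong[OF refl])
    fix j assume "j \<in> ?A"
    then have "tuple_deg b (a j) (g j)" using assms(2) free_modD(2)[OF assms(1)] by auto
    from tcomp_smult_tuple_deg[OF this, of d "u j"]
    show "smult (tcomp a d u j) (g j) = tcomp b d (smult (u j) (g j))" by (simp add: tcomp_apply)
  qed
  finally show ?thesis by (simp add: lincomb_def tcomp_sum)
qed

lemma lincomb_in:
  assumes "graded_submodule b N" "u \<in> free_mod J" "\<And>j. j \<in> J \<Longrightarrow> g j \<in> N"
  shows "lincomb g u \<in> N"
  unfolding lincomb_def using assms free_modD(2)[OF assms(2)]
  by (intro graded_submodule_sum[OF assms(1)] graded_submoduleD(3)[OF assms(1)]) auto

lemma graded_hom_lincomb:
  assumes "graded_submodule b N" "\<And>j. j \<in> J \<Longrightarrow> g j \<in> N" "\<And>j. j \<in> J \<Longrightarrow> tuple_deg b (a j) (g j)"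
  shows "graded_hom (free_mod J) a N b (lincomb g)"
  unfolding graded_hom_def
proof (intro conjI ballI allI impI)
  fix u assume u: "u \<in> free_mod J"
  show "lincomb g u \<in> N" using lincomb_in assms(1,2) u by blast
  show "lincomb g (smult p u) = smult p (lincomb g u)" for p
    using u by (rule lincomb_smult)
  show "lincomb g (u + v) = lincomb g u + lincomb g v" if "v \<in> free_mod J" for v
    using u that by (rule lincomb_add)
  show "tuple_deg b d (lincomb g u)" if "tuple_deg a d u" for d
    using lincomb_tcomp[of u J b a g d, OF u assms(3)] tuple_deg_tcomp[of b d "lincomb g u"] tcomp_tuple_deg[OF that]
    by simp
qed

lemma graded_submodule_kernel:
  assumes "\<And>j. j \<in> J \<Longrightarrow> tuple_deg b (a j) (g j)"
  shows "graded_submodule a {u \<in> free_mod J. lincomb g u = 0}"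
  unfolding graded_submodule_def
  by (auto simp: free_mod_add lincomb_add free_mod_smult lincomb_smult free_mod_tcomp
      lincomb_tcomp[of _ J b a g, OF _ assms])

lemma no_constant_terms_imp_irrelevant_mult:
  assumes "u \<in> free_mod J" "\<And>j. Poly_Mapping.lookup (u j) 0 = 0"
  shows "u \<in> irrelevant_mult (free_mod J)"
proof -
  have "\<exists>q. u j = (\<Sum>i\<in>UNIV. X i * q i) \<and> (u j = 0 \<longrightarrow> q = (\<lambda>_. 0))" for j
    using no_constant_term_imp[OF assms(2)] by (cases "u j = 0") auto
  then have "\<exists>q. \<forall>j. u j = (\<Sum>i\<in>UNIV. X i * q j i) \<and> (u j = 0 \<longrightarrow> q j = (\<lambda>_. 0))"
    by (intro choice allI)
  then obtain q where q: "\<And>j. u j = (\<Sum>i\<in>UNIV. X i * q j i)" "\<And>j. u j = 0 \<Longrightarrow> q j = (\<lambda>_. 0)"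
    by blast
  have "(\<lambda>j. q j i) \<in> free_mod J" for i
    using assms(1) by (rule free_mod_mono[rotated]) (auto simp: q(2))
  moreover have "u = (\<Sum>i\<in>UNIV. smult (X i) (\<lambda>j. q j i))"
    by (rule ext) (simp add: sum_fun_apply q(1))
  ultimately show ?thesis by (rule irrelevant_multI)
qed

lemma irrelevant_mult_subset:
  assumes "graded_submodule a N"
  shows "irrelevant_mult N \<subseteq> N"
proof
  fix u assume "u \<in> irrelevant_mult N"
  then obtain G where G: "\<And>i. G i \<in> N" "u = (\<Sum>i\<in>UNIV. smult (X i) (G i))"
    by (auto simp: irrelevant_mult_iff)
  show "u \<in> N" unfolding G(2)
    by (intro graded_submodule_sum[OF assms] graded_submoduleD(3)[OF assms] G(1))
qed

lemma tcomp_neg: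
  assumes "u \<in> free_mod I" "\<And>j. j \<in> I \<Longrightarrow> b \<le> a j" "tuple_deg a d u" "d < b"
  shows "u = 0"
proof (rule ext)
  fix j
  show "u j = 0 j"
  proof (cases "j \<in> I")
    case True
    then have "d - a j < 0" using assms(2,4) by force
    moreover have "homogeneous (d - a j) (u j)" using assms(3) by (simp add: tuple_deg_def)
    ultimately show ?thesis using homogeneous_neg by simp
  next
    case False
    then show ?thesis using free_modD(2)[OF assms(1)] by auto
  qed
qed

lemma free_mod_sum_tcomp:
  assumes "u \<in> free_mod I"
  obtains D where "finite D" "u = (\<Sum>d\<in>D. tcomp a d u)"
proof -
  let ?A = "{j. u j \<noteq> 0}"
  let ?D = "\<Union>j\<in>?A. (\<lambda>e. e + a j) ` mdeg ` Poly_Mapping.keys (u j)"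
  have fin: "finite ?D" using free_modD(1)[OF assms] by auto
  have "u j = (\<Sum>d\<in>?D. hcomp (d - a j) (u j))" for j
  proof -
    have "u j = (\<Sum>d\<in>(\<lambda>d. d - a j) ` ?D. hcomp d (u j))"
      using fin by (intro sum_hcomp) (force simp: image_iff)+
    also have "\<dots> = (\<Sum>d\<in>?D. hcomp (d - a j) (u j))"
      by (subst sum.reindex) (auto simp: inj_on_def)
    finally show ?thesis .
  qed
  then have "u = (\<Sum>d\<in>?D. tcomp a d u)"
    by (intro ext) (simp only: sum_fun_apply tcomp_apply)
  then show ?thesis using that fin by blast
qed

text \<open>The set \<open>G\<close> is a basis of a complement of the degree \<open>d\<close> part of \<open>(x\<^sub>0, x\<^sub>1, x\<^sub>2) N\<close> in the
  degree \<open>d\<close> part of \<open>N\<close>.\<close>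

lemma complement_basis:
  assumes N: "graded_submodule a N"
  obtains C G :: "('i \<Rightarrow> poly3) set"
  where "tuple_space.independent (C \<union> G)" "C \<inter> G = {}"
    "C \<union> G \<subseteq> {u \<in> N. tuple_deg a d u}"
    "tuple_space.span C = {u \<in> irrelevant_mult N. tuple_deg a d u}"
    "{u \<in> N. tuple_deg a d u} = tuple_space.span (C \<union> G)"
proof -
  let ?Nd = "{u \<in> N. tuple_deg a d u}" and ?Id = "{u \<in> irrelevant_mult N. tuple_deg a d u}"
  note NI = graded_submoduleD[OF N]
  have subN: "tuple_space.subspace ?Nd"
    by (auto simp: tuple_space.subspace_def NI tuple_deg_add tuple_deg_const)
  have subI: "tuple_space.subspace ?Id"
    using irrelevant_mult_0[OF N] irrelevant_mult_add[OF N] irrelevant_mult_smult[OF N]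
    by (auto simp: tuple_space.subspace_def tuple_deg_add tuple_deg_const)
  have IN: "?Id \<subseteq> ?Nd"
    using irrelevant_mult_subset[OF N] by auto
  obtain C where C: "C \<subseteq> ?Id" "tuple_space.independent C" "?Id \<subseteq> tuple_space.span C"
    using tuple_space.maximal_independent_subset by blast
  obtain E where E: "C \<subseteq> E" "E \<subseteq> ?Nd" "tuple_space.independent E" "?Nd \<subseteq> tuple_space.span E"
    using tuple_space.maximal_independent_subset_extend[of C ?Nd] C IN by blast
  have CE: "C \<union> (E - C) = E" using E(1) by blast
  have sC: "tuple_space.span C = ?Id"
    using C(3) tuple_space.span_minimal[OF C(1) subI] by (rule equalityI[rotated])
  have sE: "?Nd = tuple_space.span E"
    using E(4) tuple_space.span_minimal[OF E(2) subN] by (rule equalityI)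
  show ?thesis
  proof (rule that[of C "E - C"], unfold CE)
    show "C \<inter> (E - C) = {}" by blast
  qed (fact E(2,3) sC sE)+
qed

text \<open>\<open>(J, a', g)\<close> describes a minimal homogeneous generating set of \<open>N\<close>: the generators \<open>g j\<close>
  of degree \<open>a' j\<close>, \<open>j \<in> J\<close>, admit only relations without constant terms.\<close>

definition minimal_generating_family ::
  "('i \<Rightarrow> int) \<Rightarrow> ('i \<Rightarrow> poly3) set \<Rightarrow> nat set \<Rightarrow> (nat \<Rightarrow> int) \<Rightarrow> (nat \<Rightarrow> 'i \<Rightarrow> poly3) \<Rightarrow> bool" where
  "minimal_generating_family a N J a' g \<longleftrightarrow>
     (\<forall>j\<in>J. g j \<in> N \<and> tuple_deg a (a' j) (g j)) \<and>
     lincomb g ` free_mod J = N \<and>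
     (\<forall>u\<in>free_mod J. lincomb g u = 0 \<longrightarrow> (\<forall>j. Poly_Mapping.lookup (u j) 0 = 0))"

lemma lincomb_unit:
  "lincomb g (\<lambda>k. if k = j then p else 0) = smult p (g j)"
  by (subst lincomb_eq_sum[of "{j}"]) auto

text \<open>The generators of degree \<open>d\<close> are a basis of a complement of \<open>(x\<^sub>0, x\<^sub>1, x\<^sub>2) N\<close> in degree \<open>d\<close>.
  No finiteness is needed: countably many generators suffice because all tuples lie in a real
  vector space of countable dimension. The lower bound on the degrees makes the graded Nakayama
  argument work.\<close>

lemma exists_minimal_generating_family:
  fixes N :: "('i \<Rightarrow> poly3) set"
  assumes N: "graded_submodule a N" and sub: "N \<subseteq> free_mod I" and "countable I"
    and bound: "\<And>i. i \<in> I \<Longrightarrow> b \<le> a i"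
  obtains J a' g where "minimal_generating_family a N J a' g" "\<And>j. j \<in> J \<Longrightarrow> b \<le> a' j"
    "\<And>d u. u \<in> N \<Longrightarrow> tuple_deg a d u \<Longrightarrow> u \<notin> irrelevant_mult N \<Longrightarrow> \<exists>j\<in>J. a' j = d"
proof -
  note NI = graded_submoduleD[OF N]
  define part where "part d = {u \<in> N. tuple_deg a d u}" for d
  define Q where "Q d C G \<longleftrightarrow> tuple_space.independent (C \<union> G) \<and> C \<inter> G = {} \<and>
      C \<union> G \<subseteq> part d \<and> tuple_space.span C = {u \<in> irrelevant_mult N. tuple_deg a d u} \<and>
      part d = tuple_space.span (C \<union> G)" for d and C G :: "('i \<Rightarrow> poly3) set"
  have "\<exists>C G. Q d C G" for d
    unfolding Q_def part_def by (rule complement_basis[OF N, of d], intro exI conjI)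
  then have "\<exists>C. \<forall>d. \<exists>G. Q d (C d) G" by (intro choice allI)
  then obtain C where "\<forall>d. \<exists>G. Q d (C d) G" by (rule exE)
  then have "\<exists>G. \<forall>d. Q d (C d) (G d)" by (rule choice)
  then obtain G where Q: "\<And>d. Q d (C d) (G d)" by blast
  have indep: "tuple_space.independent (C d \<union> G d)" and disj: "C d \<inter> G d = {}" and
    CG: "C d \<union> G d \<subseteq> part d" and
    spanC: "tuple_space.span (C d) = {u \<in> irrelevant_mult N. tuple_deg a d u}" and
    spanCG: "part d = tuple_space.span (C d \<union> G d)" for d
    by (insert Q[of d, unfolded Q_def], elim conjE, assumption)+
  \<comment> \<open>the generators, tagged with their degrees, are numbered by natural numbers\<close>
  define \<Gamma> where "\<Gamma> = Sigma UNIV G"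
  have "countable (G d)" for d
  proof (rule countable_independent_tuples[OF \<open>countable I\<close>])
    show "G d \<subseteq> free_mod I" using CG[of d] sub by (auto simp: part_def)
    show "tuple_space.independent (G d)"
      by (rule tuple_space.independent_mono[OF indep[of d]]) auto
  qed
  then have cnt: "countable \<Gamma>" unfolding \<Gamma>_def by (intro countable_SIGMA) auto
  define J where "J = to_nat_on \<Gamma> ` \<Gamma>"
  define a' where "a' j = fst (inv_into \<Gamma> (to_nat_on \<Gamma>) j)" for j
  define g where "g j = snd (inv_into \<Gamma> (to_nat_on \<Gamma>) j)" for j
  have inj: "inj_on (to_nat_on \<Gamma>) \<Gamma>" using cnt by (rule inj_on_to_nat_on)
  have J\<Gamma>: "(a' j, g j) \<in> \<Gamma>" if "j \<in> J" for j
    using that inv_into_into[of j "to_nat_on \<Gamma>" \<Gamma>] unfolding J_def a'_def g_def by simp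
  then have gG: "g j \<in> G (a' j)" if "j \<in> J" for j
    using that by (auto simp: \<Gamma>_def)
  then have g_part: "g j \<in> part (a' j)" if "j \<in> J" for j
    using CG that by blast
  have index: "\<exists>j\<in>J. a' j = d \<and> g j = v" if "v \<in> G d" for d v
  proof (intro bexI[of _ "to_nat_on \<Gamma> (d, v)"])
    have "(d, v) \<in> \<Gamma>" using that by (simp add: \<Gamma>_def)
    then show "a' (to_nat_on \<Gamma> (d, v)) = d \<and> g (to_nat_on \<Gamma> (d, v)) = v" "to_nat_on \<Gamma> (d, v) \<in> J"
      using inj by (auto simp: J_def a'_def g_def)
  qed
  have ag_inj: "j = k" if "j \<in> J" "k \<in> J" "a' j = a' k" "g j = g k" for j k
  proof -
    have "inv_into \<Gamma> (to_nat_on \<Gamma>) j = inv_into \<Gamma> (to_nat_on \<Gamma>) k"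
      using that(3,4) unfolding a'_def g_def by (simp add: prod_eq_iff)
    then show ?thesis using that(1,2) unfolding J_def by (metis f_inv_into_f)
  qed
  have gN: "g j \<in> N" and gdeg: "tuple_deg a (a' j) (g j)" if "j \<in> J" for j
    using g_part[OF that] by (auto simp: part_def)
  have part_neg: "part d \<subseteq> {0}" if "d < b" for d
    using tcomp_neg[of _ I b a d, OF _ bound _ that] sub by (auto simp: part_def)
  have G_bound: "b \<le> a' j" if "j \<in> J" for j
  proof (rule ccontr)
    assume "\<not> b \<le> a' j"
    then have "g j = 0" using g_part[OF that] part_neg[of "a' j"] by auto
    then have "0 \<in> C (a' j) \<union> G (a' j)" using gG[OF that] by simp
    then show False using indep tuple_space.dependent_zero by blast
  qed
  let ?L = "lincomb g ` free_mod J"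
  have L: "tuple_space.subspace ?L" "\<And>p u. u \<in> ?L \<Longrightarrow> smult p u \<in> ?L"
    "\<And>u v. u \<in> ?L \<Longrightarrow> v \<in> ?L \<Longrightarrow> u + v \<in> ?L" "0 \<in> ?L"
  proof -
    show s: "smult p u \<in> ?L" if "u \<in> ?L" for p u
      using that by (auto simp: lincomb_smult[symmetric] intro!: imageI free_mod_smult)
    show ad: "u + v \<in> ?L" if "u \<in> ?L" "v \<in> ?L" for u v
      using that by (auto simp: lincomb_add[symmetric] intro!: imageI free_mod_add)
    show z: "0 \<in> ?L" by (rule image_eqI[of _ _ 0]) auto
    show "tuple_space.subspace ?L"
      unfolding tuple_space.subspace_def using s ad z by blast
  qed
  have sumL: "sum f A \<in> ?L" if "\<And>x. x \<in> A \<Longrightarrow> f x \<in> ?L" for f and A :: "'x set"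
    using that by (induction A rule: infinite_finite_induct) (auto intro: L(3,4) simp del: image_iff)
  have G_L: "G d \<subseteq> ?L" for d
  proof
    fix v assume "v \<in> G d"
    then obtain j where j: "j \<in> J" "g j = v" using index by blast
    show "v \<in> ?L"
    proof (rule image_eqI)
      show "v = lincomb g (\<lambda>k. if k = j then 1 else 0)" by (simp add: lincomb_unit j(2))
      show "(\<lambda>k. if k = j then 1 else 0) \<in> free_mod J" using j by (auto simp: free_mod_def)
    qed
  qed
  \<comment> \<open>graded Nakayama: the generators span each degree, by induction on the degree\<close>
  have part_L: "part d \<subseteq> ?L" if "d < b + int n" for n d
    using that
  proof (induction n arbitrary: d)
    case base: 0
    then show ?case using part_neg[of d] L(4) by auto
  next
    case (Suc n)
    have "C d \<subseteq> ?L"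
    proof
      fix v assume "v \<in> C d"
      then have "v \<in> tuple_space.span (C d)" by (rule tuple_space.span_base)
      then have "v \<in> irrelevant_mult N" "tuple_deg a d v" using spanC by auto
      then obtain H where H: "\<And>i. H i \<in> N" "\<And>i. tuple_deg a (d - 1) (H i)" "v = (\<Sum>i\<in>UNIV. smult (X i) (H i))"
        using irrelevant_mult_tuple_deg[OF N] by blast
      have "H i \<in> ?L" for i
        using Suc.IH[of "d - 1"] Suc.prems H(1,2)[of i] by (auto simp: part_def)
      then show "v \<in> ?L" unfolding H(3) by (intro sumL L(2))
    qed
    then have "C d \<union> G d \<subseteq> ?L" using G_L by simp
    then show ?case unfolding spanCG using L(1) by (rule tuple_space.span_minimal)
  qed
  have "?L = N"
  proof
    show "?L \<subseteq> N" using lincomb_in[of a N _ J g, OF N _ gN] by auto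
    show "N \<subseteq> ?L"
    proof
      fix u assume u: "u \<in> N"
      then have "u \<in> free_mod I" using sub by auto
      then obtain D where "finite D" and D: "u = (\<Sum>d\<in>D. tcomp a d u)"
        by (rule free_mod_sum_tcomp)
      have "tcomp a d u \<in> ?L" for d
      proof -
        have "tcomp a d u \<in> part d" using u NI(4) tuple_deg_tcomp by (simp add: part_def)
        moreover have "d < b + int (nat (d - b + 1))" by simp
        ultimately show ?thesis using part_L by blast
      qed
      then have "(\<Sum>d\<in>D. tcomp a d u) \<in> ?L" by (intro sumL)
      then show "u \<in> ?L" using D by simp
    qed
  qed
  moreover have "Poly_Mapping.lookup (u j) 0 = 0" if u: "u \<in> free_mod J" and "lincomb g u = 0" for u j
  proof (rule ccontr)
    assume c: "Poly_Mapping.lookup (u j) 0 \<noteq> 0"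
    let ?A = "{k. u k \<noteq> 0}" and ?c = "\<lambda>k. Poly_Mapping.single 0 (Poly_Mapping.lookup (u k) 0)"
    have A: "finite ?A" "?A \<subseteq> J" by (rule free_modD[OF u])+
    have jA: "j \<in> ?A" using c by auto
    then have jJ: "j \<in> J" using A by auto
    define d where "d = a' j"
    define A1 where "A1 = {k \<in> ?A. a' k = d}"
    define s2 where "s2 = (\<Sum>k\<in>?A - A1. smult (hcomp (d - a' k) (u k)) (g k))"
    have A1: "A1 \<subseteq> ?A" "j \<in> A1" "finite A1" using A jA by (auto simp: A1_def d_def)
    \<comment> \<open>the degree \<open>d\<close> part of the relation, where the generators of degree \<open>d\<close> have constant coefficients\<close>
    have "0 = lincomb g (tcomp a' d u)"
      using lincomb_tcomp[of u J a a' g d, OF u gdeg] \<open>lincomb g u = 0\<close> by simp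
    also have "\<dots> = (\<Sum>k\<in>?A. smult (tcomp a' d u k) (g k))"
      using A(1) by (rule lincomb_eq_sum) (auto simp: tcomp_def)
    also have "\<dots> = s2 + (\<Sum>k\<in>A1. smult (tcomp a' d u k) (g k))"
      unfolding s2_def tcomp_apply using sum.subset_diff[OF A1(1) A(1)] .
    also have "(\<Sum>k\<in>A1. smult (tcomp a' d u k) (g k)) = (\<Sum>k\<in>A1. smult (?c k) (g k))"
      by (rule sum.cong) (auto simp: A1_def tcomp_apply hcomp_eq_const)
    also have "\<dots> = smult (?c j) (g j) + (\<Sum>k\<in>A1 - {j}. smult (?c k) (g k))"
      using A1(2,3) by (rule sum.remove[rotated])
    finally have eq: "smult (?c j) (g j) = smult (- 1) s2 - (\<Sum>k\<in>A1 - {j}. smult (?c k) (g k))"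
      by (simp add: fun_eq_iff algebra_simps eq_neg_iff_add_eq_0)
    have "s2 \<in> irrelevant_mult N"
      unfolding s2_def
    proof (rule irrelevant_mult_sum[OF N])
      fix k assume "k \<in> ?A - A1"
      then have "d - a' k \<noteq> 0" "k \<in> J" using A by (auto simp: A1_def)
      then show "smult (hcomp (d - a' k) (u k)) (g k) \<in> irrelevant_mult N"
        by (intro smult_in_irrelevant_mult[OF N gN]) (auto simp: lookup_hcomp)
    qed
    moreover have "tuple_deg a d s2"
      unfolding s2_def
    proof (rule tuple_deg_sum)
      fix k assume "k \<in> ?A - A1"
      then have "k \<in> J" using A by auto
      from tuple_deg_smult[OF homogeneous_hcomp[of "d - a' k" "u k"] gdeg[OF this]]
      show "tuple_deg a d (smult (hcomp (d - a' k) (u k)) (g k))" by simp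
    qed
    ultimately have s2: "s2 \<in> tuple_space.span (C d)" using spanC by auto
    have gjd: "g j \<in> G d" using gG[OF jJ] by (simp add: d_def)
    let ?S = "tuple_space.span (C d \<union> G d - {g j})"
    have "C d \<subseteq> C d \<union> G d - {g j}" using disj[of d] gjd by auto
    then have "s2 \<in> ?S" using s2 tuple_space.span_mono by blast
    then have "smult (- 1) s2 \<in> ?S"
      using tuple_space.span_scale[of s2 _ "- 1"] by (simp add: single_uminus)
    moreover have "(\<Sum>k\<in>A1 - {j}. smult (?c k) (g k)) \<in> ?S"
    proof (intro tuple_space.span_sum tuple_space.span_scale tuple_space.span_base)
      fix k assume k: "k \<in> A1 - {j}"
      then have "k \<in> J" "a' k = d" using A by (auto simp: A1_def)
      then show "g k \<in> C d \<union> G d - {g j}" using gG[of k] ag_inj[of k j] jJ k by (auto simp: d_def)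
    qed
    ultimately have "smult (?c j) (g j) \<in> ?S" unfolding eq by (rule tuple_space.span_diff)
    then have "smult (Poly_Mapping.single 0 (1 / Poly_Mapping.lookup (u j) 0)) (smult (?c j) (g j)) \<in> ?S"
      by (rule tuple_space.span_scale)
    then have "g j \<in> ?S" using c by (simp add: smult_smult mult_single)
    then have "tuple_space.dependent (C d \<union> G d)"
      using gjd unfolding tuple_space.dependent_def by blast
    then show False using indep by blast
  qed
  ultimately have "minimal_generating_family a N J a' g"
    using gN gdeg by (auto simp: minimal_generating_family_def)
  moreover have "\<exists>j\<in>J. a' j = d" if "u \<in> N" "tuple_deg a d u" "u \<notin> irrelevant_mult N" for d u
  proof (rule ccontr)
    assume no: "\<not> (\<exists>j\<in>J. a' j = d)"
    have "G d = {}" using index[of _ d] no by blast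
    then have "part d = tuple_space.span (C d)" using spanCG by simp
    then show False using that spanC by (auto simp: part_def)
  qed
  ultimately show ?thesis using that G_bound by blast
qed

lemma minimal_generating_family_kernel:
  assumes "minimal_generating_family a N J a' g"
  shows "graded_submodule a' {u \<in> free_mod J. lincomb g u = 0}"
    and "{u \<in> free_mod J. lincomb g u = 0} \<subseteq> irrelevant_mult (free_mod J)"
  using assms graded_submodule_kernel[of J a a' g]
  by (auto simp: minimal_generating_family_def intro: no_constant_terms_imp_irrelevant_mult)

text \<open>The resolution is obtained by applying \<open>exists_minimal_generating_family\<close> to \<open>M\<close> and then
  repeatedly to the kernel of the last map. The degrees stay nonnegative in all steps.\<close>

lemma exists_minimal_resolution:
  fixes M :: "('i \<Rightarrow> poly3) set"
  assumes M: "graded_submodule (\<lambda>_. 0) M" and sub: "M \<subseteq> free_mod I" and "countable I"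
    and u: "u \<in> M" "tuple_deg (\<lambda>_. 0) D u" "u \<notin> irrelevant_mult M"
  obtains J a \<epsilon> \<delta> j where "minimal_graded_free_resolution M J a \<epsilon> \<delta>" "j \<in> J 0" "a 0 j = D"
proof -
  obtain J0 a0 g0 where 0: "minimal_generating_family (\<lambda>_. 0) M J0 a0 g0" "\<And>j. j \<in> J0 \<Longrightarrow> 0 \<le> a0 j"
    "\<exists>j\<in>J0. a0 j = D"
    using exists_minimal_generating_family[OF M sub \<open>countable I\<close> order_refl] u by metis
  let ?ker = "\<lambda>J g. {u \<in> free_mod J. lincomb g u = 0}"
  \<comment> \<open>states are triples of the index set and the shifts of the last free module and the kernel inside it\<close>
  define good where "good = (\<lambda>(J :: nat set, a :: nat \<Rightarrow> int, N :: (nat \<Rightarrow> poly3) set).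
    graded_submodule a N \<and> N \<subseteq> irrelevant_mult (free_mod J) \<and> (\<forall>j\<in>J. 0 \<le> a j))"
  define step where "step = (\<lambda>(J :: nat set, a :: nat \<Rightarrow> int, N) (J' :: nat set, a' :: nat \<Rightarrow> int, N').
    \<exists>g. minimal_generating_family a N J' a' g \<and> N' = ?ker J' g)"
  have irr_sub: "irrelevant_mult (free_mod J) \<subseteq> free_mod J" for J :: "nat set"
    by (rule irrelevant_mult_subset[OF graded_submodule_free_mod])
  have ex_step: "\<exists>y. good y \<and> step x y" if "good x" for x
  proof -
    obtain J a N where x: "x = (J, a, N)" by (cases x)
    have N: "graded_submodule a N" "N \<subseteq> free_mod J" "\<And>j. j \<in> J \<Longrightarrow> 0 \<le> a j"
      using that irr_sub[of J] by (auto simp: good_def x)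
    obtain J' a' g where "minimal_generating_family a N J' a' g" "\<And>j. j \<in> J' \<Longrightarrow> 0 \<le> a' j"
      by (rule exists_minimal_generating_family[of a N J 0, OF N(1,2) countableI_type N(3)], assumption) (rule that)
    then have "good (J', a', ?ker J' g)" "step x (J', a', ?ker J' g)"
      using minimal_generating_family_kernel[of a N J' a' g] by (auto simp: good_def step_def x)
    then show ?thesis by blast
  qed
  have "good (J0, a0, ?ker J0 g0)"
    using minimal_generating_family_kernel[OF 0(1)] 0(2) by (simp add: good_def)
  then have "\<exists>s. s 0 = (J0, a0, ?ker J0 g0) \<and> (\<forall>n. good (s n) \<and> step (s n) (s (Suc n)))"
    using dependent_nat_choice[of "\<lambda>n x. good x \<and> (n = 0 \<longrightarrow> x = (J0, a0, ?ker J0 g0))" "\<lambda>_. step"]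
      ex_step by auto
  then obtain s where s: "s 0 = (J0, a0, ?ker J0 g0)" "\<And>n. good (s n)" "\<And>n. step (s n) (s (Suc n))"
    by blast
  define J where "J n = fst (s n)" for n
  define a where "a n = fst (snd (s n))" for n
  define N where "N n = snd (snd (s n))" for n
  have s_eq: "s n = (J n, a n, N n)" for n by (simp add: J_def a_def N_def)
  have "\<exists>g. minimal_generating_family (a n) (N n) (J (Suc n)) (a (Suc n)) g \<and> N (Suc n) = ?ker (J (Suc n)) g" for n
    using s(3)[of n] by (simp add: s_eq step_def)
  then have "\<exists>g. \<forall>n. minimal_generating_family (a n) (N n) (J (Suc n)) (a (Suc n)) (g n) \<and>
      N (Suc n) = ?ker (J (Suc n)) (g n)"
    by (intro choice allI)
  then obtain g where g: "\<And>n. minimal_generating_family (a n) (N n) (J (Suc n)) (a (Suc n)) (g n)"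
    and ker: "\<And>n. N (Suc n) = ?ker (J (Suc n)) (g n)"
    by blast
  have zero: "J 0 = J0" "a 0 = a0" "N 0 = ?ker J0 g0" using s(1) by (simp_all add: J_def a_def N_def)
  have Nirr: "N n \<subseteq> irrelevant_mult (free_mod (J n))" and Ngr: "graded_submodule (a n) (N n)" for n
    using s(2)[of n] by (auto simp: s_eq good_def)
  have img: "lincomb (g n) ` free_mod (J (Suc n)) = N n" for n
    using g by (simp add: minimal_generating_family_def)
  have gfree: "g n j \<in> free_mod (J n)" "tuple_deg (a n) (a (Suc n) j) (g n j)" if "j \<in> J (Suc n)" for n j
    using g[of n] that Nirr[of n] irr_sub by (auto simp: minimal_generating_family_def)
  have "minimal_graded_free_resolution M J a (lincomb g0) (\<lambda>n. lincomb (g n))"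
    unfolding minimal_graded_free_resolution_def
  proof (intro conjI allI)
    show "graded_hom (free_mod (J 0)) (a 0) M (\<lambda>_. 0) (lincomb g0)"
      using 0(1) by (intro graded_hom_lincomb[OF M]) (auto simp: zero minimal_generating_family_def)
    show "lincomb g0 ` free_mod (J 0) = M"
      using 0(1) by (simp add: zero minimal_generating_family_def)
    show "{u \<in> free_mod (J 0). lincomb g0 u = 0} = lincomb (g 0) ` free_mod (J 1)"
      using img[of 0] by (simp add: zero)
    fix n
    show "graded_hom (free_mod (J (Suc n))) (a (Suc n)) (free_mod (J n)) (a n) (lincomb (g n))"
      by (rule graded_hom_lincomb[OF graded_submodule_free_mod gfree])
    show "{u \<in> free_mod (J (Suc n)). lincomb (g n) u = 0} = lincomb (g (Suc n)) ` free_mod (J (Suc (Suc n)))"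
      using img[of "Suc n"] ker by simp
    show "lincomb (g n) ` free_mod (J (Suc n)) \<subseteq> irrelevant_mult (free_mod (J n))"
      using img Nirr by simp
  qed
  moreover obtain j where "j \<in> J 0" "a 0 j = D" using 0(3) zero by auto
  ultimately show ?thesis using that by blast
qed

theorem minimal_generator_imp_reg_ge:
  fixes M :: "('i \<Rightarrow> poly3) set"
  assumes "graded_submodule (\<lambda>_. 0) M" "M \<subseteq> free_mod I" "countable I" "minimal_generator M D u"
  shows "ereal (of_int D) \<le> reg M"
proof -
  have "u \<in> M" "tuple_deg (\<lambda>_. 0) D u" "u \<notin> irrelevant_mult M"
    using assms(4) by (auto simp: minimal_generator_def)
  from exists_minimal_resolution[OF assms(1-3) this]
  obtain J a \<epsilon> \<delta> j where R: "minimal_graded_free_resolution M J a \<epsilon> \<delta>" "j \<in> J 0" "a 0 j = D" .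
  have "\<exists>J a \<epsilon> \<delta> i j. ereal (of_int D) = ereal (of_int (a i j - int i))
      \<and> minimal_graded_free_resolution M J a \<epsilon> \<delta> \<and> j \<in> J i"
    using R by (intro exI[of _ J] exI[of _ a] exI[of _ \<epsilon>] exI[of _ \<delta>] exI[of _ 0] exI[of _ j]) auto
  then show ?thesis unfolding reg_def by (intro Sup_upper CollectI)
qed

section \<open>Splines as graded modules\<close>

lemma graded_submodule_splines: "graded_submodule (\<lambda>_. 0) (splines r P)"
  unfolding graded_submodule_def
proof (intro conjI ballI allI)
  show "0 \<in> splines r P" by (simp add: splines_def)
  fix u assume u: "u \<in> splines r P"
  show "u + v \<in> splines r P" if "v \<in> splines r P" for v
    using u that unfolding splines_def by (simp add: add_diff_add)
  show "smult p u \<in> splines r P" for p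
    using u unfolding splines_def by (simp flip: right_diff_distrib)
  show "tcomp (\<lambda>_. 0) d u \<in> splines r P" for d
  proof -
    have "lin_form c ^ (r + 1) dvd hcomp d (u \<sigma>) - hcomp d (u \<sigma>')"
      if "lin_form c ^ (r + 1) dvd u \<sigma> - u \<sigma>'" for c \<sigma> \<sigma>'
      using dvd_hcomp[OF homogeneous_power[OF homogeneous_lin_form] that] by (simp add: hcomp_diff)
    then show ?thesis using u unfolding splines_def by (simp add: tcomp_apply)
  qed
qed

lemma splines_subset_free_mod:
  assumes "finite P"
  shows "splines r P \<subseteq> free_mod (facets P)"
proof
  fix F assume "F \<in> splines r P"
  then have "{\<sigma>. F \<sigma> \<noteq> 0} \<subseteq> facets P" by (auto simp: splines_def)
  moreover have "finite (facets P)" using assms by (simp add: facets_def)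
  ultimately show "F \<in> free_mod (facets P)" by (auto simp: free_mod_def intro: finite_subset)
qed

text \<open>The vector with coordinates \<open>a\<close>, \<open>b\<close>, \<open>c\<close> at the indices \<open>0\<close>, \<open>1\<close>, \<open>2\<close>.\<close>

definition vec3 :: "real \<Rightarrow> real \<Rightarrow> real \<Rightarrow> real^3" where
  "vec3 a b c = (\<chi> i. if i = 0 then a else if i = 1 then b else c)"

lemma vec3_nth [simp]: "vec3 a b c $ 0 = a" "vec3 a b c $ 1 = b" "vec3 a b c $ 2 = c"
  by (simp_all add: vec3_def)

lemma inner_vec3_lift: "vec3 a b c \<bullet> lift p = a + b * p $ 1 + c * p $ 2"
  by (simp add: inner_vec_def sum_3 vec3_def lift_def)

lemma lift_combination: "u + v = 1 \<Longrightarrow> lift (u *\<^sub>R p + v *\<^sub>R q) = u *\<^sub>R lift p + v *\<^sub>R lift q"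
  by (simp add: vec_eq_iff lift_def)

lemma lift_inj: "lift p = lift q \<longleftrightarrow> p = q"
proof
  assume h: "lift p = lift q"
  have "lift x $ 1 = x $ 1" "lift x $ 2 = x $ 2" for x by (simp_all add: lift_def)
  then have "p $ 1 = q $ 1" "p $ 2 = q $ 2" using h by metis+
  then show "p = q" by (simp add: vec_eq_iff forall_2)
qed simp

lemma independent_lift:
  assumes "p \<noteq> q"
  shows "independent {lift p, lift q}"
proof -
  have nz: "lift x \<noteq> 0" for x
  proof
    assume "lift x = 0"
    then have "lift x $ 0 = 0" by simp
    then show False by (simp add: lift_def)
  qed
  have "lift p \<notin> span {lift q}"
  proof
    assume "lift p \<in> span {lift q}"
    then obtain k where k: "lift p = k *\<^sub>R lift q" by (auto simp: span_singleton)
    then have "lift p $ 0 = k * lift q $ 0" by simp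
    then have "k = 1" by (simp add: lift_def)
    then show False using k assms lift_inj by simp
  qed
  then show ?thesis using nz assms lift_inj by (simp add: independent_insert)
qed

lemma defines_span_segment:
  assumes "p \<noteq> q" "c \<bullet> lift p = 0" "c \<bullet> lift q = 0" "c \<noteq> 0"
  shows "defines_span c (convex hull {p, q})"
proof -
  let ?S = "span {lift p, lift q}"
  have "lift ` (convex hull {p, q}) \<subseteq> ?S"
  proof
    fix x assume "x \<in> lift ` (convex hull {p, q})"
    then obtain u v where "u + v = 1" "x = lift (u *\<^sub>R p + v *\<^sub>R q)" by (auto simp: convex_hull_2)
    then have "x = u *\<^sub>R lift p + v *\<^sub>R lift q" by (simp add: lift_combination)
    then show "x \<in> ?S" by (auto intro: span_add span_scale span_base)
  qed
  then have "span (lift ` (convex hull {p, q})) \<subseteq> ?S" by (rule span_minimal[OF _ subspace_span])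
  moreover have "{lift p, lift q} \<subseteq> lift ` (convex hull {p, q})" by (auto simp: hull_inc)
  then have "?S \<subseteq> span (lift ` (convex hull {p, q}))" by (rule span_mono)
  moreover have "?S = {v. c \<bullet> v = 0}"
  proof (rule subspace_dim_equal)
    show "subspace {v. c \<bullet> v = 0}" by (rule subspace_hyperplane)
    then show "?S \<subseteq> {v. c \<bullet> v = 0}" using assms(2,3) by (intro span_minimal) auto
    have "dim ?S = 2" using independent_lift[OF assms(1)] lift_inj assms(1)
      by (simp add: dim_eq_card_independent)
    moreover have "dim {v. c \<bullet> v = 0} = 2" using dim_hyperplane[OF assms(4)] by simp
    ultimately show "dim {v. c \<bullet> v = 0} \<le> dim ?S" by simp
  qed simp
  ultimately show ?thesis by (simp add: defines_span_def)
qed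

lemma spline_dvd:
  assumes "F \<in> splines r P" "\<sigma> \<in> facets P" "\<sigma>' \<in> facets P" "\<sigma> \<noteq> \<sigma>'"
    and "convex hull {p, q} \<in> edges \<sigma> \<inter> edges \<sigma>'" "p \<noteq> q"
    and "c \<bullet> lift p = 0" "c \<bullet> lift q = 0" "c \<noteq> 0"
  shows "lin_form c ^ (r + 1) dvd F \<sigma> - F \<sigma>'"
  using assms defines_span_segment[OF assms(6-9)] unfolding splines_def by blast

lemma proportional_if_hyperplane_subset:
  fixes c c' :: "'a::real_inner"
  assumes "\<And>v. c \<bullet> v = 0 \<Longrightarrow> c' \<bullet> v = 0"
  obtains t where "c' = t *\<^sub>R c"
proof (cases "c = 0")
  case True
  then have "c' \<bullet> c' = 0" by (intro assms) simp
  then show ?thesis using that[of 0] by simp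
next
  case False
  define t where "t = (c' \<bullet> c) / (c \<bullet> c)"
  define v where "v = c' - t *\<^sub>R c"
  have "c \<bullet> v = 0" using False by (simp add: v_def t_def inner_diff_right inner_commute)
  moreover from this have "c' \<bullet> v = 0" by (rule assms)
  ultimately have "v \<bullet> v = 0" by (simp add: v_def inner_diff_left inner_commute)
  then show ?thesis using that[of t] by (simp add: v_def)
qed

lemma lin_form_scaleR: "lin_form (t *\<^sub>R c) = Poly_Mapping.single 0 t * lin_form c"
  by (simp add: lin_form_def sum_distrib_left mult_single flip: mult.assoc)

text \<open>In checking that a tuple is a spline, it suffices to know for each edge one linear form that
  vanishes on the edge and satisfies the divisibility condition: a form defining the span of the edge
  divides it.\<close>

lemma single_facet_spline:
  assumes "\<sigma> \<in> facets P"
    and "\<And>\<sigma>' \<tau>. \<sigma>' \<in> facets P \<Longrightarrow> \<sigma>' \<noteq> \<sigma> \<Longrightarrow> \<tau> \<in> edges \<sigma> \<inter> edges \<sigma>' \<Longrightarrow>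
      \<exists>c. (\<forall>x\<in>\<tau>. c \<bullet> lift x = 0) \<and> lin_form c ^ (r + 1) dvd L"
  shows "(\<lambda>\<rho>. if \<rho> = \<sigma> then L else 0) \<in> splines r P"
proof -
  have *: "lin_form c ^ (r + 1) dvd L"
    if s': "\<sigma>' \<in> facets P" "\<sigma>' \<noteq> \<sigma>" "\<tau> \<in> edges \<sigma> \<inter> edges \<sigma>'" and c: "defines_span c \<tau>" for \<sigma>' \<tau> c
  proof -
    obtain c' where c': "\<And>x. x \<in> \<tau> \<Longrightarrow> c' \<bullet> lift x = 0" "lin_form c' ^ (r + 1) dvd L"
      using assms(2)[OF s'] by blast
    have "span (lift ` \<tau>) \<subseteq> {v. c' \<bullet> v = 0}"
      using c'(1) by (intro span_minimal subspace_hyperplane) auto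
    then have "c' \<bullet> v = 0" if "c \<bullet> v = 0" for v
      using c that unfolding defines_span_def by blast
    then obtain t where "c' = t *\<^sub>R c" by (rule proportional_if_hyperplane_subset)
    then have "lin_form c ^ (r + 1) dvd lin_form c' ^ (r + 1)"
      by (intro dvd_power_same) (simp add: lin_form_scaleR)
    then show ?thesis using c'(2) by (rule dvd_trans)
  qed
  show ?thesis
    unfolding splines_def mem_Collect_eq
  proof (intro conjI allI ballI impI)
    fix \<rho> \<rho>' \<tau> c
    assume a: "\<rho> \<in> facets P" "\<rho>' \<in> facets P" "\<rho> \<noteq> \<rho>'" "\<tau> \<in> edges \<rho> \<inter> edges \<rho>'" "defines_span c \<tau>"
    show "lin_form c ^ (r + 1) dvd (if \<rho> = \<sigma> then L else 0) - (if \<rho>' = \<sigma> then L else 0)"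
    proof (cases "\<rho> = \<sigma>")
      case True
      then show ?thesis using *[of \<rho>' \<tau> c] a by auto
    next
      case False
      then show ?thesis using *[of \<rho> \<tau> c] a by auto
    qed
  next
    fix \<rho> assume "\<rho> \<notin> facets P"
    then show "(if \<rho> = \<sigma> then L else 0) = 0" using assms(1) by auto
  qed
qed

section \<open>Restriction to a line and a criterion for minimal generators\<close>

text \<open>The homomorphism \<open>restr\<close> substitutes \<open>1, 0, t\<close> for the three variables, that is, it restricts
  forms to the line \<open>x\<^sub>1 = 0\<close> in an affine coordinate; \<open>restr_term m c\<close> is the image of the monomial
  \<open>m\<close> with coefficient \<open>c\<close>.\<close>

definition restr_term :: "(3 \<Rightarrow>\<^sub>0 nat) \<Rightarrow> real \<Rightarrow> real poly" where
  "restr_term m c = (if Poly_Mapping.lookup m 1 = 0 then monom c (Poly_Mapping.lookup m 2) else 0)"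

definition restr :: "poly3 \<Rightarrow> real poly" where
  "restr p = (\<Sum>m\<in>Poly_Mapping.keys p. restr_term m (Poly_Mapping.lookup p m))"

lemma restr_term_0 [simp]: "restr_term m 0 = 0"
  by (simp add: restr_term_def)

lemma restr_term_add: "restr_term m (c + d) = restr_term m c + restr_term m d"
  by (simp add: restr_term_def add_monom)

lemma restr_eq_sum:
  "finite A \<Longrightarrow> Poly_Mapping.keys p \<subseteq> A \<Longrightarrow> restr p = (\<Sum>m\<in>A. restr_term m (Poly_Mapping.lookup p m))"
  unfolding restr_def by (rule sum.mono_neutral_left) (auto simp: in_keys_iff)

lemma restr_single: "restr (Poly_Mapping.single m c) = restr_term m c"
  by (subst restr_eq_sum[of "{m}"]) auto

lemma restr_add: "restr (p + q) = restr p + restr q"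
proof -
  let ?A = "Poly_Mapping.keys p \<union> Poly_Mapping.keys q"
  have "restr (p + q) = (\<Sum>m\<in>?A. restr_term m (Poly_Mapping.lookup (p + q) m))"
    by (rule restr_eq_sum) (auto simp: keys_add)
  moreover have "restr p = (\<Sum>m\<in>?A. restr_term m (Poly_Mapping.lookup p m))"
    by (rule restr_eq_sum) auto
  moreover have "restr q = (\<Sum>m\<in>?A. restr_term m (Poly_Mapping.lookup q m))"
    by (rule restr_eq_sum) auto
  ultimately show ?thesis by (simp add: lookup_add restr_term_add sum.distrib)
qed

lemma restr_0 [simp]: "restr 0 = 0"
  by (simp add: restr_def)

lemma restr_uminus: "restr (- p) = - restr p"
  using restr_add[of p "- p"] by (simp add: eq_neg_iff_add_eq_0 add.commute)

lemma restr_diff: "restr (p - q) = restr p - restr q"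
  using restr_add[of p "- q"] by (simp add: restr_uminus)

lemma restr_sum: "restr (sum f A) = (\<Sum>x\<in>A. restr (f x))"
  by (induction A rule: infinite_finite_induct) (auto simp: restr_add)

lemma restr_mult: "restr (p * q) = restr p * restr q"
proof (induction p rule: poly3_additive_induct)
  case (single m c)
  show ?case
  proof (induction q rule: poly3_additive_induct)
    case (single m' c')
    show ?case
      by (simp add: mult_single restr_single restr_term_def lookup_add mult_monom)
  qed (simp add: distrib_left restr_add)
qed (simp add: distrib_right restr_add)

lemma restr_1 [simp]: "restr 1 = 1"
  using restr_single[of 0 1] by (simp add: restr_term_def)

lemma restr_power: "restr (p ^ k) = restr p ^ k"
  by (induction k) (simp_all add: restr_mult)

lemma restr_prod: "restr (prod f A) = (\<Prod>x\<in>A. restr (f x))"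
  by (induction A rule: infinite_finite_induct) (auto simp: restr_mult)

lemma restr_dvd: "p dvd q \<Longrightarrow> restr p dvd restr q"
  by (auto simp: dvd_def restr_mult)

lemma restr_lin_form: "restr (lin_form c) = [:c $ 0, c $ 2:]"
proof -
  have "restr (Poly_Mapping.single 0 a * X i) = (if i = 0 then [:a:] else if i = 1 then 0 else [:0, a:])" for a i
  proof -
    have "i = 0 \<or> i = 1 \<or> i = 2" using exhaust_3[of i] three_eq_0 by auto
    then show ?thesis
      by (auto simp: X_def mult_single restr_single restr_term_def lookup_single when_def monom_0 monom_Suc
          numeral_2_eq_2)
  qed
  then show ?thesis by (simp add: lin_form_def restr_add sum_3 three_eq_0)
qed

lemma degree_restr:
  assumes "homogeneous (int d) p"
  shows "degree (restr p) \<le> d"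
  unfolding restr_def
proof (rule degree_sum_le)
  fix m assume "m \<in> Poly_Mapping.keys p"
  then have "mdeg m = int d" using assms by (simp add: homogeneous_iff in_keys_iff)
  then have "(\<Sum>i\<in>UNIV. Poly_Mapping.lookup m i) = d" unfolding mdeg_def by (simp only: of_nat_eq_iff)
  then have "Poly_Mapping.lookup m 2 \<le> d" by (simp add: sum_3)
  then show "degree (restr_term m (Poly_Mapping.lookup p m)) \<le> d"
    using degree_monom_le[of "Poly_Mapping.lookup p m" "Poly_Mapping.lookup m 2"] by (auto simp: restr_term_def)
qed simp

lemma poly_eq_0_if_roots:
  fixes p :: "real poly"
  assumes "finite A" "0 < k" "\<And>x. x \<in> A \<Longrightarrow> [:- x, 1:] ^ k dvd p" "degree p < card A * k"
  shows "p = 0"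
proof (rule ccontr)
  assume nz: "p \<noteq> 0"
  have ord: "k \<le> order x p" if "x \<in> A" for x
    using assms(3)[OF that] nz by (simp add: order_divides)
  have "card A * k \<le> (\<Sum>x\<in>A. order x p)"
    using sum_mono[of A "\<lambda>_. k" "\<lambda>x. order x p"] ord by simp
  also have "\<dots> \<le> (\<Sum>x | poly p x = 0. order x p)"
  proof (rule sum_mono2)
    show "finite {x. poly p x = 0}" using nz by (rule poly_roots_finite)
    show "A \<subseteq> {x. poly p x = 0}" using ord assms(2) nz by (force simp: order_root)
  qed auto
  also have "\<dots> \<le> degree p" using nz by (rule sum_order_le_degree)
  finally show False using assms(4) by simp
qed

lemma linear_power_dvd:
  fixes a b :: real
  assumes "[:a, b:] ^ k dvd p" "b \<noteq> 0"
  shows "[:- (- a / b), 1:] ^ k dvd p"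
proof -
  have "[:a, b:] = [:b:] * [:- (- a / b), 1:]" using assms(2) by simp
  then have "[:- (- a / b), 1:] dvd [:a, b:]" by (metis dvd_triv_right)
  then show ?thesis using assms(1) dvd_power_same dvd_trans by blast
qed

text \<open>If \<open>\<Lambda>\<close> is a linear functional on tuples whose restriction to the line has zeros of order
  \<open>r + 1\<close> at all points of \<open>A\<close> for every spline, then the restriction vanishes on splines of degree
  less than \<open>card A * (r + 1)\<close>, and therefore on the elements of \<open>(x\<^sub>0, x\<^sub>1, x\<^sub>2) C\<^sup>r\<close> of degree
  \<open>card A * (r + 1)\<close>.\<close>

lemma minimal_generator_if_restr:
  assumes F: "F \<in> splines r P" "tuple_deg (\<lambda>_. 0) (int (card A * (r + 1))) F"
    and A: "finite A" "A \<noteq> {}"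
    and lin: "\<And>G. \<Lambda> (\<Sum>i\<in>UNIV. smult (X i) (G i)) = (\<Sum>i\<in>UNIV. X i * \<Lambda> (G i))"
    and hom: "\<And>G d. tuple_deg (\<lambda>_. 0) d G \<Longrightarrow> homogeneous d (\<Lambda> G)"
    and div: "\<And>G x. G \<in> splines r P \<Longrightarrow> x \<in> A \<Longrightarrow> [:- x, 1:] ^ (r + 1) dvd restr (\<Lambda> G)"
    and nz: "restr (\<Lambda> F) \<noteq> 0"
  shows "minimal_generator (splines r P) (int (card A * (r + 1))) F"
  unfolding minimal_generator_def
proof (intro conjI F notI)
  let ?D = "card A * (r + 1)"
  have D: "0 < ?D" using A by (simp add: card_gt_0_iff)
  assume "F \<in> irrelevant_mult (splines r P)"
  then obtain G where G: "\<And>i. G i \<in> splines r P" "\<And>i. tuple_deg (\<lambda>_. 0) (int ?D - 1) (G i)"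
    "F = (\<Sum>i\<in>UNIV. smult (X i) (G i))"
    using irrelevant_mult_tuple_deg[OF graded_submodule_splines _ F(2)] by blast
  have "restr (\<Lambda> (G i)) = 0" for i
  proof (rule poly_eq_0_if_roots[OF A(1), of "r + 1"])
    have "int ?D - 1 = int (?D - 1)" using D by (simp only: of_nat_diff Suc_leI)
    then have "homogeneous (int (?D - 1)) (\<Lambda> (G i))" using hom[OF G(2)[of i]] by (simp only:)
    then have "degree (restr (\<Lambda> (G i))) \<le> ?D - 1" by (rule degree_restr)
    then show "degree (restr (\<Lambda> (G i))) < card A * (r + 1)" using D by linarith
  qed (use div G(1) in auto)
  then have "restr (\<Lambda> F) = 0" unfolding G(3) lin restr_sum restr_mult by simp
  then show False using nz by contradiction
qed

section \<open>Complexes generated by polytopes\<close>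

text \<open>Polygons any two of which meet in a common face are the facets of the complex of all their
  faces.\<close>

lemma complex_of_cells:
  assumes fin: "finite T" and cells: "\<And>\<sigma>. \<sigma> \<in> T \<Longrightarrow> polytope \<sigma>" "\<And>\<sigma>. \<sigma> \<in> T \<Longrightarrow> aff_dim \<sigma> = 2"
    and meet: "\<And>\<sigma> \<sigma>'. \<sigma> \<in> T \<Longrightarrow> \<sigma>' \<in> T \<Longrightarrow> \<sigma> \<noteq> \<sigma>' \<Longrightarrow> (\<sigma> \<inter> \<sigma>') face_of \<sigma>"
  defines "P \<equiv> {\<tau>. \<exists>\<sigma>\<in>T. \<tau> face_of \<sigma>}"
  shows "polytopal_complex P" "facets P = T" "two_faces P = T" "pure_2dim P"
proof -
  have conv: "convex \<sigma>" if "\<sigma> \<in> T" for \<sigma> using cells(1)[OF that] by (rule polytope_imp_convex)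
  have inter: "(\<tau> \<inter> \<tau>') face_of \<tau>" if "\<sigma> \<in> T" "\<sigma>' \<in> T" "\<tau> face_of \<sigma>" "\<tau>' face_of \<sigma>'" for \<sigma> \<sigma>' \<tau> \<tau>'
  proof -
    have "(\<tau>' \<inter> \<sigma>) face_of (\<sigma>' \<inter> \<sigma>)" using that(4) conv[OF that(1)] by (rule face_of_slice)
    moreover have "(\<sigma>' \<inter> \<sigma>) face_of \<sigma>"
      using meet[OF that(1,2)] face_of_refl[OF conv[OF that(1)]] by (cases "\<sigma> = \<sigma>'") (auto simp: Int_commute)
    ultimately have "(\<tau>' \<inter> \<sigma>) face_of \<sigma>" by (rule face_of_trans)
    then have "(\<tau> \<inter> (\<tau>' \<inter> \<sigma>)) face_of \<sigma>" by (rule face_of_Int[OF that(3)])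
    moreover have "\<tau> \<inter> (\<tau>' \<inter> \<sigma>) = \<tau> \<inter> \<tau>'" using face_of_imp_subset[OF that(3)] by auto
    ultimately show ?thesis using face_of_subset[of _ \<sigma> \<tau>] face_of_imp_subset[OF that(3)] by auto
  qed
  have "finite (\<Union>\<sigma>\<in>T. {\<tau>. \<tau> face_of \<sigma>})"
    using fin cells(1) by (intro finite_UN_I finite_polytope_faces)
  moreover have "P = (\<Union>\<sigma>\<in>T. {\<tau>. \<tau> face_of \<sigma>})" by (auto simp: P_def)
  ultimately have "finite P" by simp
  moreover have "polytope \<tau>" if "\<tau> \<in> P" for \<tau>
    using that cells(1) face_of_polytope_polytope by (auto simp: P_def)
  moreover have "\<tau>' \<in> P" if "\<tau> \<in> P" "\<tau>' face_of \<tau>" for \<tau> \<tau>'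
    using that face_of_trans by (auto simp: P_def)
  moreover have "(\<tau> \<inter> \<tau>') face_of \<tau>" "(\<tau> \<inter> \<tau>') face_of \<tau>'" if "\<tau> \<in> P" "\<tau>' \<in> P" for \<tau> \<tau>'
    using that inter Int_commute[of \<tau> \<tau>'] unfolding P_def by fastforce+
  ultimately show "polytopal_complex P" by (simp add: polytopal_complex_def)
  have TP: "T \<subseteq> P" using face_of_refl conv by (auto simp: P_def)
  have full: "\<tau> \<in> T" if "\<tau> \<in> P" "aff_dim \<tau> = 2" for \<tau>
  proof -
    obtain \<sigma> where "\<sigma> \<in> T" "\<tau> face_of \<sigma>"
      using \<open>\<tau> \<in> P\<close> unfolding P_def by blast
    then show ?thesis using face_of_aff_dim_lt[of \<sigma> \<tau>] conv[of \<sigma>] cells(2)[of \<sigma>] that(2) by auto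
  qed
  show "two_faces P = T" using full TP cells(2) by (auto simp: two_faces_def)
  have max: "\<tau> = \<sigma>" if "\<sigma> \<in> T" "\<tau> \<in> P" "\<sigma> \<subseteq> \<tau>" for \<sigma> \<tau>
  proof -
    obtain \<sigma>' where s': "\<sigma>' \<in> T" "\<tau> face_of \<sigma>'"
      using \<open>\<tau> \<in> P\<close> unfolding P_def by blast
    then have sub: "\<tau> \<subseteq> \<sigma>'" by (auto dest: face_of_imp_subset)
    have "\<sigma> = \<sigma>'"
    proof (rule ccontr)
      assume ne: "\<sigma> \<noteq> \<sigma>'"
      have "(\<sigma>' \<inter> \<sigma>) face_of \<sigma>'" using meet[OF s'(1) that(1)] ne by auto
      moreover have "\<sigma>' \<inter> \<sigma> = \<sigma>" using sub that(3) by auto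
      ultimately have "aff_dim \<sigma> < aff_dim \<sigma>'"
        using face_of_aff_dim_lt[of \<sigma>' \<sigma>] conv[OF s'(1)] ne by auto
      then show False using cells(2) that(1) s'(1) by simp
    qed
    then show ?thesis using sub that(3) by auto
  qed
  show "facets P = T"
  proof
    show "T \<subseteq> facets P" using max TP unfolding facets_def by blast
    show "facets P \<subseteq> T"
    proof
      fix \<tau> assume t: "\<tau> \<in> facets P"
      then have "\<tau> \<in> P" by (simp add: facets_def)
      then obtain \<sigma> where s: "\<sigma> \<in> T" "\<tau> face_of \<sigma>" by (auto simp: P_def)
      then have "\<sigma> \<in> P" "\<tau> \<subseteq> \<sigma>" using TP face_of_imp_subset by auto
      then have "\<sigma> = \<tau>" using t by (auto simp: facets_def)
      then show "\<tau> \<in> T" using s by simp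
    qed
  qed
  then show "pure_2dim P" using cells(2) by (simp add: pure_2dim_def)
qed

text \<open>Paths of length at most two suffice if facets that meet without sharing an edge have a common
  neighbour that contains their intersection.\<close>

lemma hereditary_if_common_neighbour:
  assumes "\<And>\<sigma> \<sigma>'. \<sigma> \<in> facets P \<Longrightarrow> \<sigma>' \<in> facets P \<Longrightarrow> \<sigma> \<noteq> \<sigma>' \<Longrightarrow> \<sigma> \<inter> \<sigma>' \<noteq> {} \<Longrightarrow>
     edges \<sigma> \<inter> edges \<sigma>' \<noteq> {} \<or>
     (\<exists>\<rho>\<in>facets P. \<sigma> \<inter> \<sigma>' \<subseteq> \<rho> \<and> \<rho> \<noteq> \<sigma> \<and> \<rho> \<noteq> \<sigma>' \<and> edges \<sigma> \<inter> edges \<rho> \<noteq> {} \<and> edges \<rho> \<inter> edges \<sigma>' \<noteq> {})"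
  shows "hereditary P"
  unfolding hereditary_def Let_def
proof (intro ballI impI)
  fix \<gamma> \<sigma> \<sigma>'
  assume "\<gamma> \<noteq> {}" and s: "\<sigma> \<in> {\<sigma> \<in> facets P. \<gamma> \<subseteq> \<sigma>}" and s': "\<sigma>' \<in> {\<sigma> \<in> facets P. \<gamma> \<subseteq> \<sigma>}"
  let ?E = "{(\<sigma>, \<sigma>'). \<sigma> \<in> {\<sigma> \<in> facets P. \<gamma> \<subseteq> \<sigma>} \<and> \<sigma>' \<in> {\<sigma> \<in> facets P. \<gamma> \<subseteq> \<sigma>} \<and> \<sigma> \<noteq> \<sigma>' \<and>
     edges \<sigma> \<inter> edges \<sigma>' \<noteq> {}}"
  have "\<sigma> \<inter> \<sigma>' \<noteq> {}" using s s' \<open>\<gamma> \<noteq> {}\<close> by auto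
  show "(\<sigma>, \<sigma>') \<in> ?E\<^sup>*"
  proof (cases "\<sigma> = \<sigma>' \<or> edges \<sigma> \<inter> edges \<sigma>' \<noteq> {}")
    case True
    then show ?thesis using s s' by (cases "\<sigma> = \<sigma>'") auto
  next
    case False
    then obtain \<rho> where r: "\<rho> \<in> facets P" "\<sigma> \<inter> \<sigma>' \<subseteq> \<rho>" "\<rho> \<noteq> \<sigma>" "\<rho> \<noteq> \<sigma>'"
      "edges \<sigma> \<inter> edges \<rho> \<noteq> {}" "edges \<rho> \<inter> edges \<sigma>' \<noteq> {}"
      using assms[of \<sigma> \<sigma>'] s s' \<open>\<sigma> \<inter> \<sigma>' \<noteq> {}\<close> by auto
    have "\<gamma> \<subseteq> \<rho>" using r(2) s s' by auto
    then have "(\<sigma>, \<rho>) \<in> ?E" "(\<rho>, \<sigma>') \<in> ?E" using r s s' by auto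
    then show ?thesis by (meson r_into_rtrancl rtrancl_trans)
  qed
qed

lemma shared_edge:
  fixes p q :: "'a::euclidean_space"
  assumes "convex hull {p, q} face_of \<sigma>" "convex hull {p, q} face_of \<sigma>'" "p \<noteq> q"
  shows "convex hull {p, q} \<in> edges \<sigma> \<inter> edges \<sigma>'"
  using assms by (simp add: edges_def aff_dim_convex_hull)

lemma convex_hull_Int_supporting_hyperplane:
  fixes V :: "'a::euclidean_space set"
  assumes "finite V" "\<And>v. v \<in> V \<Longrightarrow> a \<bullet> v \<le> b"
  shows "convex hull V \<inter> {x. a \<bullet> x = b} = convex hull {v \<in> V. a \<bullet> v = b}"
    and "convex hull {v \<in> V. a \<bullet> v = b} face_of convex hull V"
proof -
  have "convex hull V \<subseteq> {x. a \<bullet> x \<le> b}"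
    using assms(2) by (intro hull_minimal) (auto simp: convex_halfspace_le)
  then have face: "(convex hull V \<inter> {x. a \<bullet> x = b}) face_of convex hull V"
    by (intro face_of_Int_supporting_hyperplane_le) auto
  then obtain S where S: "S \<subseteq> V" "convex hull V \<inter> {x. a \<bullet> x = b} = convex hull S"
    using face_of_convex_hull_subset[OF finite_imp_compact[OF assms(1)]] by metis
  have "S \<subseteq> {v \<in> V. a \<bullet> v = b}" using S hull_subset[of S convex] by auto
  then have "convex hull S \<subseteq> convex hull {v \<in> V. a \<bullet> v = b}" by (rule hull_mono)
  moreover have "convex hull {v \<in> V. a \<bullet> v = b} \<subseteq> convex hull V \<inter> {x. a \<bullet> x = b}"
    using hull_subset[of V convex] by (intro hull_minimal convex_Int convex_convex_hull convex_hyperplane) auto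
  ultimately show eq: "convex hull V \<inter> {x. a \<bullet> x = b} = convex hull {v \<in> V. a \<bullet> v = b}"
    using S by auto
  show "convex hull {v \<in> V. a \<bullet> v = b} face_of convex hull V" using face eq by simp
qed

text \<open>The intersection of \<open>\<sigma>\<close> and \<open>\<sigma>'\<close> is a common face, the convex hull of \<open>E\<close>.\<close>

definition meet_in :: "'a::euclidean_space set \<Rightarrow> 'a set \<Rightarrow> 'a set \<Rightarrow> bool" where
  "meet_in E \<sigma> \<sigma>' \<longleftrightarrow> \<sigma> \<inter> \<sigma>' = convex hull E \<and> convex hull E face_of \<sigma> \<and> convex hull E face_of \<sigma>'"

lemma meet_in_sym: "meet_in E \<sigma> \<sigma>' \<Longrightarrow> meet_in E \<sigma>' \<sigma>"
  by (auto simp: meet_in_def)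

text \<open>Two polytopes that lie on different sides of a hyperplane and are spanned by point sets that
  agree on the hyperplane meet in a common face.\<close>

lemma meet_in_if_separated:
  fixes V W :: "'a::euclidean_space set"
  assumes "finite V" "finite W" "\<And>v. v \<in> V \<Longrightarrow> a \<bullet> v \<le> b" "\<And>w. w \<in> W \<Longrightarrow> b \<le> a \<bullet> w"
    "{v \<in> V. a \<bullet> v = b} = E" "{w \<in> W. a \<bullet> w = b} = E"
  shows "meet_in E (convex hull V) (convex hull W)"
proof -
  note V = convex_hull_Int_supporting_hyperplane[of V a b, OF assms(1,3), unfolded assms(5)]
  have W: "convex hull W \<inter> {x. a \<bullet> x = b} = convex hull E" "convex hull E face_of convex hull W"
    using convex_hull_Int_supporting_hyperplane[of W "- a" "- b"] assms(2,4,6) by auto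
  have "convex hull V \<subseteq> {x. a \<bullet> x \<le> b}"
    using assms(3) by (intro hull_minimal) (auto simp: convex_halfspace_le)
  moreover have "convex hull W \<subseteq> {x. a \<bullet> x \<ge> b}"
    using assms(4) by (intro hull_minimal) (auto simp: convex_halfspace_ge)
  ultimately have "convex hull V \<inter> convex hull W \<subseteq> {x. a \<bullet> x = b}" by force
  then have "convex hull V \<inter> convex hull W = convex hull E" using V(1) W(1) by blast
  then show ?thesis using V(2) W(2) by (simp add: meet_in_def)
qed

section \<open>Edges of convex polygons\<close>

text \<open>Twice the signed area of the triangle \<open>p q r\<close>.\<close>

definition orient :: "real^2 \<Rightarrow> real^2 \<Rightarrow> real^2 \<Rightarrow> real" where
  "orient p q r = (q $ 1 - p $ 1) * (r $ 2 - p $ 2) - (q $ 2 - p $ 2) * (r $ 1 - p $ 1)"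

lemma orient_rotate: "orient q r p = orient p q r"
  by (simp add: orient_def algebra_simps)

lemma orient_swap2: "orient p r q = - orient p q r"
  by (simp add: orient_def algebra_simps)

lemma orient_eq_inner:
  "orient p q x = vector [p $ 2 - q $ 2, q $ 1 - p $ 1] \<bullet> x - vector [p $ 2 - q $ 2, q $ 1 - p $ 1] \<bullet> p"
  by (simp add: orient_def inner_vec_def sum_2 algebra_simps)

lemma aff_dim_eq_2_if_orient:
  assumes "orient p q r \<noteq> 0" "p \<in> S" "q \<in> S" "r \<in> S"
  shows "aff_dim S = 2"
proof -
  have "\<not> collinear S"
  proof
    assume "collinear S"
    then obtain u where u: "\<And>x y. x \<in> S \<Longrightarrow> y \<in> S \<Longrightarrow> \<exists>c. x - y = c *\<^sub>R u"
      by (auto simp: collinear_def)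
    obtain c d where cd: "q - p = c *\<^sub>R u" "r - p = d *\<^sub>R u"
      using u[OF assms(3,2)] u[OF assms(4,2)] by blast
    have "q $ i - p $ i = c * u $ i" "r $ i - p $ i = d * u $ i" for i
      using arg_cong[OF cd(1), of "\<lambda>x. x $ i"] arg_cong[OF cd(2), of "\<lambda>x. x $ i"] by simp_all
    then have "orient p q r = 0" by (simp add: orient_def)
    then show False using assms(1) by simp
  qed
  then have "\<not> aff_dim S \<le> 1" by (simp add: collinear_aff_dim)
  moreover have "aff_dim S \<le> 2" using aff_dim_le_DIM[of S] by simp
  ultimately show ?thesis by simp
qed

text \<open>An affine function that vanishes at \<open>p\<close> and \<open>q\<close> is proportional to \<open>orient p q\<close>.\<close>

lemma orient_proportional:
  assumes "a \<bullet> p = b" "a \<bullet> q = b"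
  shows "(a \<bullet> x - b) * orient p q y = (a \<bullet> y - b) * orient p q x"
proof -
  have p: "b = a$1 * p$1 + a$2 * p$2" and d: "a$1 * (q$1 - p$1) + a$2 * (q$2 - p$2) = 0"
    using assms by (simp_all add: inner_vec_def sum_2 algebra_simps)
  have "(a \<bullet> x - b) * orient p q y - (a \<bullet> y - b) * orient p q x =
      (a$1 * (q$1 - p$1) + a$2 * (q$2 - p$2)) *
        ((x$1 - p$1) * (y$2 - p$2) - (x$2 - p$2) * (y$1 - p$1))"
    unfolding orient_def inner_vec_def sum_2 inner_real_def p by (simp add: algebra_simps)
  then show ?thesis unfolding d by simp
qed

text \<open>The points \<open>v 0, \<dots>, v (N - 1)\<close> are in strictly convex position and listed in cyclic order,
  counterclockwise for \<open>s > 0\<close> and clockwise for \<open>s < 0\<close>.\<close>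

locale convex_polygon =
  fixes v :: "nat \<Rightarrow> real^2" and N :: nat and s :: real
  assumes N: "3 \<le> N"
    and pos: "\<And>i j k. i < j \<Longrightarrow> j < k \<Longrightarrow> k < N \<Longrightarrow> 0 < s * orient (v i) (v j) (v k)"
begin

abbreviation "V \<equiv> v ` {..<N}"

lemma orient_nonzero:
  assumes "i < N" "j < N" "k < N" "i \<noteq> j" "j \<noteq> k" "i \<noteq> k"
  shows "orient (v i) (v j) (v k) \<noteq> 0"
proof -
  have *: "orient (v i) (v j) (v k) \<noteq> 0" if "i < j" "j < k" "k < N" for i j k
    using pos[OF that] by auto
  consider "i < j" "j < k" | "i < k" "k < j" | "j < i" "i < k" | "j < k" "k < i" | "k < i" "i < j" | "k < j" "j < i"
    using assms(4-6) by linarith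
  then show ?thesis
    using *[of i j k] *[of i k j] *[of j i k] *[of j k i] *[of k i j] *[of k j i] assms(1-3)
    by cases (auto simp: orient_def algebra_simps)
qed

lemma inj: "inj_on v {..<N}"
proof (rule inj_onI, rule ccontr)
  fix i j assume ij: "i \<in> {..<N}" "j \<in> {..<N}" "v i = v j" "i \<noteq> j"
  have "card {i, j} < card {..<N}" using N ij(4) by simp
  then have "{..<N} - {i, j} \<noteq> {}"
    by (metis Diff_eq_empty_iff card_mono finite.emptyI finite.insertI not_less)
  then obtain k where "k < N" "k \<noteq> i" "k \<noteq> j" by auto
  then show False using orient_nonzero[of i j k] ij by (simp add: orient_def)
qed

lemma aff_dim_2: "aff_dim (convex hull V) = 2"
proof -
  have "v i \<in> V" if "i < 3" for i using that N by auto
  then show ?thesis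
    unfolding aff_dim_convex_hull using N orient_nonzero[of 0 1 2]
    by (intro aff_dim_eq_2_if_orient[of "v 0" "v 1" "v 2"]) auto
qed

text \<open>A segment between two vertices; it is a diagonal unless the vertices are adjacent.\<close>

definition side :: "nat \<Rightarrow> nat \<Rightarrow> (real^2) set" where
  "side i j = convex hull {v i, v j}"

lemma mem_side:
  assumes "i < N" "j < N" "k < N" "i \<noteq> j" "v k \<in> side i j"
  shows "k = i \<or> k = j"
proof (rule ccontr)
  assume "\<not> ?thesis"
  then have "orient (v i) (v j) (v k) \<noteq> 0" using assms orient_nonzero by auto
  moreover have "v i \<in> side i j" "v j \<in> side i j" by (auto simp: side_def hull_inc)
  ultimately have "aff_dim (side i j) = 2" using assms(5) by (intro aff_dim_eq_2_if_orient)
  then show False by (simp add: side_def aff_dim_convex_hull split: if_splits)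
qed

lemma side_eq:
  assumes "i < j" "j < N" "i' < j'" "j' < N" "side i j = side i' j'"
  shows "i = i' \<and> j = j'"
proof -
  have "v i' \<in> side i j" "v j' \<in> side i j"
    unfolding assms(5) by (auto simp: side_def hull_inc)
  then show ?thesis using mem_side[of i j i'] mem_side[of i j j'] assms(1-4) by auto
qed

lemma side_face:
  assumes "i < j" "j < N" "j = Suc i \<or> i = 0 \<and> Suc j = N"
  shows "side i j \<in> edges (convex hull V)"
proof -
  define t where "t = (if j = Suc i then - s else s)"
  have ij: "v i \<noteq> v j" using inj assms(1,2) by (auto simp: inj_on_def)
  have neg: "t * orient (v i) (v j) (v k) < 0" if k: "k < N" "k \<noteq> i" "k \<noteq> j" for k
  proof (cases "j = Suc i")
    case True
    then consider "k < i" | "j < k" using k by linarith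
    then show ?thesis
    proof cases
      case 1
      then show ?thesis using pos[of k i j] assms orient_rotate[of "v i" "v j" "v k"] True by (simp add: t_def)
    next
      case 2
      then show ?thesis using pos[of i j k] assms k True by (simp add: t_def)
    qed
  next
    case False
    then have "i < k" "k < j" using assms k by auto
    then show ?thesis using pos[of i k j] assms orient_swap2[of "v i" "v j" "v k"] False by (simp add: t_def)
  qed
  define n where "n = t *\<^sub>R (vector [v i $ 2 - v j $ 2, v j $ 1 - v i $ 1] :: real^2)"
  have n: "n \<bullet> x - n \<bullet> v i = t * orient (v i) (v j) x" for x
    unfolding orient_eq_inner n_def by (simp add: algebra_simps)
  have le: "n \<bullet> x \<le> n \<bullet> v i" if x: "x \<in> V" for x
  proof -
    obtain k where k: "k < N" "x = v k" using x by blast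
    have "t * orient (v i) (v j) (v k) \<le> 0"
      using neg[of k] k(1) by (cases "k = i \<or> k = j") (auto simp: orient_def)
    then show ?thesis using n[of x] k by simp
  qed
  have "{x \<in> V. n \<bullet> x = n \<bullet> v i} = {v i, v j}"
  proof (intro equalityI subsetI)
    fix x assume x: "x \<in> {x \<in> V. n \<bullet> x = n \<bullet> v i}"
    then obtain k where k: "k < N" "x = v k" by blast
    moreover have "t * orient (v i) (v j) (v k) = 0" using n[of x] x k by simp
    ultimately show "x \<in> {v i, v j}" using neg[of k] by force
  next
    fix x assume "x \<in> {v i, v j}"
    then have "x \<in> V" "t * orient (v i) (v j) x = 0" using assms(1,2) by (auto simp: orient_def)
    then have "x \<in> V" "n \<bullet> x - n \<bullet> v i = 0" using n[of x] by simp_all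
    then show "x \<in> {x \<in> V. n \<bullet> x = n \<bullet> v i}" by simp
  qed
  then have "side i j face_of convex hull V"
    using convex_hull_Int_supporting_hyperplane(2)[of V n "n \<bullet> v i", OF _ le] by (simp add: side_def)
  then show ?thesis using ij by (simp add: edges_def side_def aff_dim_convex_hull)
qed

text \<open>An edge contains exactly two vertices. It cannot be a diagonal, since a supporting line
  would have vertices strictly on both sides.\<close>

lemma edge_is_side:
  assumes "\<tau> \<in> edges (convex hull V)"
  obtains i j where "i < j" "j < N" "j = Suc i \<or> i = 0 \<and> Suc j = N" "\<tau> = side i j"
proof -
  have face: "\<tau> face_of convex hull V" and dim: "aff_dim \<tau> = 1" using assms by (auto simp: edges_def)
  obtain S where S: "S \<subseteq> V" "\<tau> = convex hull S"
    using face_of_convex_hull_subset[OF _ face] by (metis finite_imageI finite_imp_compact finite_lessThan)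
  have three: False if "i < N" "j < N" "k < N" "i \<noteq> j" "j \<noteq> k" "i \<noteq> k" "v i \<in> \<tau>" "v j \<in> \<tau>" "v k \<in> \<tau>" for i j k
    using aff_dim_eq_2_if_orient[of "v i" "v j" "v k" \<tau>] orient_nonzero[of i j k] that dim by auto
  have "\<not> (\<exists>p. S \<subseteq> {p})"
  proof
    assume "\<exists>p. S \<subseteq> {p}"
    then obtain p where "S \<subseteq> {p}" by blast
    then have "aff_dim S \<le> 0" using aff_dim_subset[of S "{p}"] by simp
    then show False using dim S by (simp add: aff_dim_convex_hull)
  qed
  then obtain p q where "p \<in> S" "q \<in> S" "p \<noteq> q" by blast
  then obtain i0 j0 where "i0 < N" "j0 < N" "v i0 \<in> S" "v j0 \<in> S" "i0 \<noteq> j0" using S(1) by blast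
  then obtain i j where ij: "i < j" "j < N" "v i \<in> S" "v j \<in> S"
    by (cases "i0 < j0") (blast intro: that, meson linorder_neqE_nat)
  have in\<tau>: "v i \<in> \<tau>" "v j \<in> \<tau>" using ij S(2) by (auto simp: hull_inc)
  have out: "v k \<notin> \<tau>" if "k < N" "k \<noteq> i" "k \<noteq> j" for k
    using three[of i j k] ij in\<tau> that by auto
  have "S = {v i, v j}" using out S ij hull_inc[of _ S convex] by fastforce
  then have side: "\<tau> = side i j" using S by (simp add: side_def)
  have "polyhedron (convex hull V)" by (simp add: polytope_imp_polyhedron polytope_convex_hull)
  then have "\<tau> exposed_face_of convex hull V" using face exposed_face_of_polyhedron by blast
  then obtain a b where ab: "convex hull V \<subseteq> {x. a \<bullet> x \<le> b}" "\<tau> = convex hull V \<inter> {x. a \<bullet> x = b}"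
    by (auto simp: exposed_face_of_def)
  have lt: "a \<bullet> v k < b" if "k < N" "k \<noteq> i" "k \<noteq> j" for k
  proof -
    have "v k \<in> convex hull V" using that by (auto simp: hull_inc)
    then show ?thesis using ab out[OF that] by force
  qed
  have "j = Suc i \<or> i = 0 \<and> Suc j = N"
  proof (rule ccontr)
    assume not_adj: "\<not> ?thesis"
    \<comment> \<open>\<open>k\<close> and \<open>l\<close> are vertices on different sides of the diagonal\<close>
    define k where "k = Suc i"
    define l where "l = (if i = 0 then Suc j else 0)"
    have k: "i < k" "k < j" using not_adj ij by (auto simp: k_def)
    have l: "l < i \<or> j < l" "l < N" using not_adj ij by (auto simp: l_def)
    have "s * orient (v i) (v j) (v k) < 0"
      using pos[of i k j] k ij orient_swap2[of "v i" "v j" "v k"] by simp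
    moreover have "0 < s * orient (v i) (v j) (v l)"
      using pos[of l i j] pos[of i j l] l ij orient_rotate[of "v i" "v j" "v l"] by auto
    moreover have "(a \<bullet> v k - b) * orient (v i) (v j) (v l) = (a \<bullet> v l - b) * orient (v i) (v j) (v k)"
      using in\<tau> ab by (intro orient_proportional) auto
    then have "(a \<bullet> v k - b) * (s * orient (v i) (v j) (v l)) = (a \<bullet> v l - b) * (s * orient (v i) (v j) (v k))"
      by (simp only: mult.left_commute[of _ s])
    moreover have "a \<bullet> v k - b < 0" "a \<bullet> v l - b < 0" using lt[of k] lt[of l] k l ij by auto
    ultimately show False
      using mult_neg_pos[of "a \<bullet> v k - b"] mult_neg_neg[of "a \<bullet> v l - b"] by (metis less_asym)
  qed
  then show ?thesis using that ij(1,2) side by blast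
qed

lemma card_edges: "card (edges (convex hull V)) = N"
proof -
  let ?I = "insert (0, N - 1) ((\<lambda>i. (i, Suc i)) ` {..<N - 1})"
  have img: "edges (convex hull V) = (\<lambda>(i, j). side i j) ` ?I"
  proof
    show "edges (convex hull V) \<subseteq> (\<lambda>(i, j). side i j) ` ?I"
    proof
      fix \<tau> assume "\<tau> \<in> edges (convex hull V)"
      then obtain i j where "i < j" "j < N" "j = Suc i \<or> i = 0 \<and> Suc j = N" "\<tau> = side i j"
        by (rule edge_is_side)
      then show "\<tau> \<in> (\<lambda>(i, j). side i j) ` ?I" by (intro image_eqI[of _ _ "(i, j)"]) auto
    qed
    show "(\<lambda>(i, j). side i j) ` ?I \<subseteq> edges (convex hull V)"
      using N by (auto intro!: side_face)
  qed
  have inj: "inj_on (\<lambda>(i, j). side i j) ?I"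
  proof (rule inj_onI, clarify)
    fix i j i' j' assume "(i, j) \<in> ?I" "(i', j') \<in> ?I" "side i j = side i' j'"
    moreover from this have "i < j" "j < N" "i' < j'" "j' < N" using N by auto
    ultimately show "i = i' \<and> j = j'" using side_eq by blast
  qed
  have "card ?I = N"
  proof -
    have "(0, N - 1) \<notin> (\<lambda>i. (i, Suc i)) ` {..<N - 1}" using N by auto
    moreover have "card ((\<lambda>i. (i, Suc i)) ` {..<N - 1}) = N - 1"
      by (subst card_image) (auto simp: inj_on_def)
    ultimately show ?thesis using N by simp
  qed
  then show ?thesis by (simp only: img card_image[OF inj])
qed

end

section \<open>Complexes with numbered facets\<close>

text \<open>Planar polygons that meet at most in common vertices and edges, such that cells that meet
  without sharing an edge have a common neighbour containing their intersection.\<close>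

locale cell_complex =
  fixes cell :: "nat \<Rightarrow> (real^2) set" and K :: nat
  assumes polytope_cell: "\<And>k. k < K \<Longrightarrow> polytope (cell k)"
    and aff_dim_cell: "\<And>k. k < K \<Longrightarrow> aff_dim (cell k) = 2"
    and meet: "\<And>k l. k < l \<Longrightarrow> l < K \<Longrightarrow> \<exists>E. finite E \<and> card E \<le> 2 \<and> meet_in E (cell k) (cell l)"
    and connected: "\<And>k l. k < l \<Longrightarrow> l < K \<Longrightarrow> cell k \<inter> cell l \<noteq> {} \<Longrightarrow>
      edges (cell k) \<inter> edges (cell l) \<noteq> {} \<or>
      (\<exists>m<K. m \<noteq> k \<and> m \<noteq> l \<and> cell k \<inter> cell l \<subseteq> cell m \<and>
        edges (cell k) \<inter> edges (cell m) \<noteq> {} \<and> edges (cell m) \<inter> edges (cell l) \<noteq> {})"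
begin

text \<open>The polytopal complex with these facets.\<close>

definition "complex = {\<tau>. \<exists>\<sigma>\<in>cell ` {..<K}. \<tau> face_of \<sigma>}"

lemma meet': "k < K \<Longrightarrow> l < K \<Longrightarrow> k \<noteq> l \<Longrightarrow> \<exists>E. finite E \<and> card E \<le> 2 \<and> meet_in E (cell k) (cell l)"
  using meet[of k l] meet[of l k] meet_in_sym[of _ "cell l" "cell k"] by (meson linorder_neqE_nat)

lemma cell_neq:
  assumes "k < K" "l < K" "k \<noteq> l"
  shows "cell k \<noteq> cell l"
proof
  assume eq: "cell k = cell l"
  obtain E where E: "finite E" "card E \<le> 2" "meet_in E (cell k) (cell l)" using meet' assms by blast
  then have "cell k = convex hull E" using eq by (simp add: meet_in_def)
  then have "aff_dim (cell k) \<le> int (card E) - 1"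
    using aff_dim_le_card[OF E(1)] by (simp add: aff_dim_convex_hull)
  then show False using aff_dim_cell[OF assms(1)] E(2) by simp
qed

lemma inj_cell: "inj_on cell {..<K}"
  using cell_neq by (auto simp: inj_on_def)

lemma polytopal_complex: "polytopal_complex complex"
  and facets_complex: "facets complex = cell ` {..<K}"
  and two_faces_complex: "two_faces complex = cell ` {..<K}"
  and pure_2dim: "pure_2dim complex"
proof -
  have fin: "finite (cell ` {..<K})" by simp
  have poly: "polytope \<sigma>" if "\<sigma> \<in> cell ` {..<K}" for \<sigma> using that polytope_cell by auto
  have dim: "aff_dim \<sigma> = 2" if "\<sigma> \<in> cell ` {..<K}" for \<sigma> using that aff_dim_cell by auto
  have face: "(\<sigma> \<inter> \<sigma>') face_of \<sigma>"
    if *: "\<sigma> \<in> cell ` {..<K}" "\<sigma>' \<in> cell ` {..<K}" "\<sigma> \<noteq> \<sigma>'" for \<sigma> \<sigma>'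
  proof -
    obtain k l where "k < K" "l < K" "k \<noteq> l" "\<sigma> = cell k" "\<sigma>' = cell l" using * by blast
    then show ?thesis using meet'[of k l] by (auto simp: meet_in_def)
  qed
  note * = complex_of_cells[OF fin poly dim face, folded complex_def]
  show "polytopal_complex complex" "facets complex = cell ` {..<K}"
    "two_faces complex = cell ` {..<K}" "pure_2dim complex"
    by (rule *; assumption)+
qed

lemma hereditary: "hereditary complex"
proof (rule hereditary_if_common_neighbour, unfold facets_complex)
  fix \<sigma> \<sigma>' assume "\<sigma> \<in> cell ` {..<K}" "\<sigma>' \<in> cell ` {..<K}" "\<sigma> \<noteq> \<sigma>'" and int: "\<sigma> \<inter> \<sigma>' \<noteq> {}"
  then obtain k l where kl: "k < K" "l < K" "k \<noteq> l" "\<sigma> = cell k" "\<sigma>' = cell l" by blast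
  have "edges \<sigma> \<inter> edges \<sigma>' \<noteq> {} \<or>
      (\<exists>m<K. m \<noteq> k \<and> m \<noteq> l \<and> \<sigma> \<inter> \<sigma>' \<subseteq> cell m \<and>
        edges \<sigma> \<inter> edges (cell m) \<noteq> {} \<and> edges (cell m) \<inter> edges \<sigma>' \<noteq> {})"
  proof (cases "k < l")
    case True
    then show ?thesis using connected[of k l] kl int by simp
  next
    case False
    then have "l < k" using kl by simp
    then show ?thesis using connected[of l k] kl int by (auto simp: Int_commute)
  qed
  then show "edges \<sigma> \<inter> edges \<sigma>' \<noteq> {} \<or>
     (\<exists>\<rho>\<in>cell ` {..<K}. \<sigma> \<inter> \<sigma>' \<subseteq> \<rho> \<and> \<rho> \<noteq> \<sigma> \<and> \<rho> \<noteq> \<sigma>' \<and> edges \<sigma> \<inter> edges \<rho> \<noteq> {} \<and> edges \<rho> \<inter> edges \<sigma>' \<noteq> {})"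
    using cell_neq kl by (metis imageI lessThan_iff)
qed

lemma edge_counts_complex: "edge_counts complex = image_mset (\<lambda>k. card (edges (cell k))) (mset_set {..<K})"
proof -
  have "mset_set (cell ` {..<K}) = image_mset cell (mset_set {..<K})"
    using inj_cell by (rule image_mset_mset_set[symmetric])
  then show ?thesis
    by (simp add: edge_counts_def two_faces_complex multiset.map_comp comp_def)
qed

lemma max_edges_complex: "max_edges complex = Max ((\<lambda>k. card (edges (cell k))) ` {..<K})"
  by (simp add: max_edges_def two_faces_complex image_image)

lemma reg_splines_ge:
  assumes "minimal_generator (splines r complex) (int d) F"
  shows "ereal (real d) \<le> reg (splines r complex)"
proof -
  have "finite complex" using polytopal_complex by (simp add: polytopal_complex_def)
  then have "splines r complex \<subseteq> free_mod (facets complex)" by (rule splines_subset_free_mod)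
  moreover have "countable (facets complex)"
    unfolding facets_complex by (intro countable_finite) simp
  ultimately have "ereal (of_int (int d)) \<le> reg (splines r complex)"
    using minimal_generator_imp_reg_ge[OF graded_submodule_splines _ _ assms] by blast
  then show ?thesis by simp
qed

lemma supported_on_single_facet:
  "k < K \<Longrightarrow> supported_on_single_facet complex (\<lambda>\<rho>. if \<rho> = cell k then L else 0)"
  unfolding supported_on_single_facet_def facets_complex by auto

lemma spline_dvd_cells:
  assumes "F \<in> splines r complex" "k < K" "l < K" "k \<noteq> l"
    and "meet_in {p, q} (cell k) (cell l)" "p \<noteq> q"
    and "c \<bullet> lift p = 0" "c \<bullet> lift q = 0" "c \<noteq> 0"
  shows "lin_form c ^ (r + 1) dvd F (cell k) - F (cell l)"
proof -
  have "convex hull {p, q} \<in> edges (cell k) \<inter> edges (cell l)"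
    using assms(5,6) by (intro shared_edge) (auto simp: meet_in_def)
  then show ?thesis
    using spline_dvd[OF assms(1) _ _ cell_neq[OF assms(2-4)] _ assms(6-9)] assms(2,3)
    by (simp add: facets_complex)
qed

lemma single_facet_spline_cells:
  assumes "k < K"
    and "\<And>l. l < K \<Longrightarrow> l \<noteq> k \<Longrightarrow> (\<exists>p. meet_in {p} (cell k) (cell l)) \<or>
      (\<exists>p q c. meet_in {p, q} (cell k) (cell l) \<and> c \<bullet> lift p = 0 \<and> c \<bullet> lift q = 0 \<and>
        lin_form c ^ (r + 1) dvd L)"
  shows "(\<lambda>\<rho>. if \<rho> = cell k then L else 0) \<in> splines r complex"
proof (rule single_facet_spline)
  show "cell k \<in> facets complex" using assms(1) by (simp add: facets_complex)
  fix \<sigma>' \<tau>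
  assume "\<sigma>' \<in> facets complex" "\<sigma>' \<noteq> cell k" and \<tau>: "\<tau> \<in> edges (cell k) \<inter> edges \<sigma>'"
  then obtain l where l: "l < K" "l \<noteq> k" "\<sigma>' = cell l" by (auto simp: facets_complex)
  have sub: "\<tau> \<subseteq> cell k \<inter> cell l" and dim: "aff_dim \<tau> = 1"
    using \<tau> l(3) by (auto simp: edges_def dest: face_of_imp_subset)
  from assms(2)[OF l(1,2)]
  show "\<exists>c. (\<forall>x\<in>\<tau>. c \<bullet> lift x = 0) \<and> lin_form c ^ (r + 1) dvd L"
  proof (elim disjE exE conjE)
    fix p assume "meet_in {p} (cell k) (cell l)"
    then have "\<tau> \<subseteq> {p}" using sub by (simp add: meet_in_def)
    then have "aff_dim \<tau> \<le> 0" using aff_dim_subset[of \<tau> "{p}"] by simp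
    then show ?thesis using dim by simp
  next
    fix p q c assume m: "meet_in {p, q} (cell k) (cell l)" and c: "c \<bullet> lift p = 0" "c \<bullet> lift q = 0"
      and d: "lin_form c ^ (r + 1) dvd L"
    have "c \<bullet> lift x = 0" if "x \<in> \<tau>" for x
    proof -
      have "x \<in> convex hull {p, q}" using that sub m by (auto simp: meet_in_def)
      then obtain u v where "u + v = 1" "x = u *\<^sub>R p + v *\<^sub>R q" by (auto simp: convex_hull_2)
      then show ?thesis using c by (simp add: lift_combination inner_add_right)
    qed
    then show ?thesis using d by blast
  qed
qed

end

section \<open>Two wings joined by strips\<close>

lemma inner_vector2: "(vector [a, b] :: real^2) \<bullet> v = a * v $ 1 + b * v $ 2"
  by (simp add: inner_vec_def sum_2)

lemma nth_image_set: "(!) xs ` {..<length xs} = set xs"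
  by (auto simp: set_conv_nth)

lemma polygon_of_list:
  assumes "convex_polygon ((!) xs) (length xs) s"
  shows "aff_dim (convex hull set xs) = 2" "card (edges (convex hull set xs)) = length xs"
  using convex_polygon.aff_dim_2[OF assms] convex_polygon.card_edges[OF assms]
  by (simp_all add: nth_image_set)

text \<open>For \<open>s = 1\<close> these points lie on the parabola \<open>x = y\<^sup>2\<close>, for \<open>s = - 1\<close> on its mirror image.\<close>

definition pt :: "real \<Rightarrow> nat \<Rightarrow> real^2" where
  "pt s j = vector [s * real j ^ 2, real j]"

lemma pt_nth [simp]: "pt s j $ 1 = s * real j ^ 2" "pt s j $ 2 = real j"
  by (simp_all add: pt_def)

lemma pt_eq_iff: "pt s i = pt t j \<longleftrightarrow> i = j \<and> (i = 0 \<or> s = t)"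
  by (auto simp: vec_eq_iff forall_2)

text \<open>The vertices of the right (\<open>s = 1\<close>) and left (\<open>s = - 1\<close>) wing.\<close>

definition wing :: "real \<Rightarrow> nat \<Rightarrow> (real^2) set" where
  "wing s n = pt s ` {..<Suc n}"

text \<open>The vertices of the strip \<open>m \<le> y \<le> m + 1\<close> between the wings. For \<open>m = 0\<close> two of the four
  points agree and the strip is a triangle.\<close>

definition strip :: "nat \<Rightarrow> (real^2) set" where
  "strip m = {pt 1 m, pt (- 1) m, pt 1 (Suc m), pt (- 1) (Suc m)}"

lemma polygon_wing:
  assumes "2 \<le> n" "s \<noteq> 0"
  shows "convex_polygon (pt s) (Suc n) (- s)"
proof
  show "3 \<le> Suc n" using assms by simp
  fix i j k :: nat assume ijk: "i < j" "j < k"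
  have "- s * orient (pt s i) (pt s j) (pt s k)
      = s^2 * ((real j - real i) * (real k - real i) * (real k - real j))"
    by (simp add: orient_def power2_eq_square algebra_simps)
  also have "\<dots> > 0" using ijk assms(2) by (intro mult_pos_pos) auto
  finally show "0 < - s * orient (pt s i) (pt s j) (pt s k)" .
qed

lemma wing_polygon_facts:
  assumes "2 \<le> n" "s \<noteq> 0"
  shows "aff_dim (convex hull wing s n) = 2" "card (edges (convex hull wing s n)) = Suc n"
  using convex_polygon.aff_dim_2[OF polygon_wing[OF assms]] convex_polygon.card_edges[OF polygon_wing[OF assms]]
  by (simp_all add: wing_def)

lemma polygon_3:
  assumes "0 < orient p q t"
  shows "convex_polygon ((!) [p, q, t]) (length [p, q, t]) 1"
proof
  fix i j k :: nat assume "i < j" "j < k" "k < length [p, q, t]"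
  then have "i = 0" "j = 1" "k = 2" by auto
  then show "0 < 1 * orient ([p, q, t] ! i) ([p, q, t] ! j) ([p, q, t] ! k)" using assms by simp
qed simp

lemma polygon_4:
  assumes "0 < orient p q t" "0 < orient p q u" "0 < orient p t u" "0 < orient q t u"
  shows "convex_polygon ((!) [p, q, t, u]) (length [p, q, t, u]) 1"
proof
  fix i j k :: nat assume "i < j" "j < k" "k < length [p, q, t, u]"
  then have "i = 0 \<and> j = 1 \<and> k = 2 \<or> i = 0 \<and> j = 1 \<and> k = 3 \<or> i = 0 \<and> j = 2 \<and> k = 3 \<or> i = 1 \<and> j = 2 \<and> k = 3"
    by auto
  then show "0 < 1 * orient ([p, q, t, u] ! i) ([p, q, t, u] ! j) ([p, q, t, u] ! k)" using assms by auto
qed simp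

lemma strip_polygon_facts:
  shows "aff_dim (convex hull strip m) = 2" "card (edges (convex hull strip m)) = (if m = 0 then 3 else 4)"
proof -
  have "aff_dim (convex hull strip m) = 2 \<and> card (edges (convex hull strip m)) = (if m = 0 then 3 else 4)"
  proof (cases "m = 0")
    case True
    have "convex_polygon ((!) [pt 1 0, pt 1 1, pt (- 1) 1]) (length [pt 1 0, pt 1 1, pt (- 1) 1]) 1"
      by (rule polygon_3) (simp add: orient_def)
    note * = polygon_of_list[OF this]
    have "strip m = set [pt 1 0, pt 1 1, pt (- 1) 1]"
      using True by (auto simp: strip_def pt_eq_iff)
    then show ?thesis using * True by simp
  next
    case False
    let ?xs = "[pt (- 1) m, pt 1 m, pt 1 (Suc m), pt (- 1) (Suc m)]"
    have "convex_polygon ((!) ?xs) (length ?xs) 1"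
      using False by (intro polygon_4) (simp_all add: orient_def power2_eq_square algebra_simps add_pos_nonneg)
    note * = polygon_of_list[OF this]
    have "strip m = set ?xs" by (auto simp: strip_def)
    then show ?thesis using * False by simp
  qed
  then show "aff_dim (convex hull strip m) = 2" "card (edges (convex hull strip m)) = (if m = 0 then 3 else 4)"
    by simp_all
qed

lemma meet_wings: "meet_in {pt 1 0} (convex hull wing 1 n) (convex hull wing (- 1) n)"
proof (rule meet_in_sym, rule meet_in_if_separated[of _ _ "vector [1, 0]" 0])
  show "{v \<in> wing (- 1) n. vector [1, 0] \<bullet> v = 0} = {pt 1 0}"
    by (auto simp: wing_def inner_vector2 pt_eq_iff)
  show "{v \<in> wing 1 n. vector [1, 0] \<bullet> v = 0} = {pt 1 0}"
    by (auto simp: wing_def inner_vector2 pt_eq_iff)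
qed (auto simp: wing_def inner_vector2)

lemma strip_sym: "s = 1 \<or> s = - 1 \<Longrightarrow> strip m = {pt s m, pt (- s) m, pt s (Suc m), pt (- s) (Suc m)}"
  by (auto simp: strip_def)

lemma nat_gap_nonneg: "0 \<le> (real j - real m) * (real j - real m - 1)"
proof (cases "j \<le> m")
  case True
  then show ?thesis by (intro mult_nonpos_nonpos) auto
next
  case False
  then have "real m + 1 \<le> real j" by linarith
  then show ?thesis by (intro mult_nonneg_nonneg) auto
qed

text \<open>The affine function that vanishes on the line through \<open>pt s m\<close> and \<open>pt s (m + 1)\<close> takes the
  value \<open>(j - m) (j - m - 1)\<close> at \<open>pt s j\<close>, which is nonnegative as \<open>j\<close> is an integer. So this line
  separates the wing from the \<open>m\<close>-th strip.\<close>

lemma line_eq: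
  assumes "s = 1 \<or> s = - 1"
  shows "s * pt s j $ 1 - (2 * real m + 1) * pt s j $ 2 = (real j - real m) * (real j - real m - 1) - real m * (real m + 1)"
  using assms by (auto simp: power2_eq_square algebra_simps)

lemma meet_wing_strip:
  assumes s: "s = 1 \<or> s = - 1" and "m < n"
  shows "meet_in {pt s m, pt s (Suc m)} (convex hull wing s n) (convex hull strip m)"
proof (rule meet_in_sym, rule meet_in_if_separated[of _ _ "vector [s, - (2 * real m + 1)]" "- (real m * (real m + 1))"])
  let ?a = "vector [s, - (2 * real m + 1)] :: real^2" and ?b = "- (real m * (real m + 1))"
  have ss: "s * s = 1" using s by auto
  have near: "?a \<bullet> pt s j = (real j - real m) * (real j - real m - 1) + ?b" for j
    using line_eq[OF s, of j m] by (simp add: inner_vector2 algebra_simps)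
  have far: "?a \<bullet> pt (- s) m = - 2 * real m ^ 2 + ?b" "?a \<bullet> pt (- s) (Suc m) = - 2 * (real m + 1) ^ 2 + ?b"
    using s by (auto simp: inner_vector2 power2_eq_square algebra_simps)
  show "?a \<bullet> v \<le> ?b" if "v \<in> strip m" for v
    using that near[of m] near[of "Suc m"] far unfolding strip_sym[OF s] by auto
  show "?b \<le> ?a \<bullet> w" if "w \<in> wing s n" for w
    using that near nat_gap_nonneg[of _ m] by (auto simp: wing_def)
  have "(real m + 1) ^ 2 \<noteq> 0" by (simp add: add_nonneg_eq_0_iff)
  then have far_eq: "?a \<bullet> pt (- s) m = ?b \<longleftrightarrow> m = 0" "?a \<bullet> pt (- s) (Suc m) \<noteq> ?b"
    unfolding far by auto
  have near_eq: "?a \<bullet> pt s j = ?b \<longleftrightarrow> j = m \<or> j = Suc m" for j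
    unfolding near by auto
  have "pt (- s) 0 = pt s 0" by (simp add: pt_eq_iff)
  then show "{v \<in> strip m. ?a \<bullet> v = ?b} = {pt s m, pt s (Suc m)}"
    unfolding strip_sym[OF s] using far_eq near_eq[of m] near_eq[of "Suc m"] by auto
  show "{w \<in> wing s n. ?a \<bullet> w = ?b} = {pt s m, pt s (Suc m)}"
    using \<open>m < n\<close> near_eq by (auto simp: wing_def)
qed (auto simp: wing_def strip_def)

lemma meet_strips:
  assumes "k < l"
  shows "meet_in (if l = Suc k then {pt 1 l, pt (- 1) l} else {}) (convex hull strip k) (convex hull strip l)"
proof (rule meet_in_if_separated[of _ _ "vector [0, 1]" "(real k + real l + 1) / 2"])
  show "{v \<in> strip k. vector [0, 1] \<bullet> v = (real k + real l + 1) / 2} = (if l = Suc k then {pt 1 l, pt (- 1) l} else {})"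
    using assms by (auto simp: strip_def inner_vector2 field_simps)
  show "{v \<in> strip l. vector [0, 1] \<bullet> v = (real k + real l + 1) / 2} = (if l = Suc k then {pt 1 l, pt (- 1) l} else {})"
    using assms by (auto simp: strip_def inner_vector2 field_simps)
qed (use assms in \<open>auto simp: strip_def inner_vector2 field_simps\<close>)

text \<open>The cells are the right wing, the \<open>n\<close> strips, and the left wing, in this order.\<close>

definition wing_cell :: "nat \<Rightarrow> nat \<Rightarrow> (real^2) set" where
  "wing_cell n k = convex hull (if k = 0 then wing 1 n else if k = Suc n then wing (- 1) n else strip (k - 1))"

lemma wing_cell_simps:
  "wing_cell n 0 = convex hull wing 1 n" "wing_cell n (Suc n) = convex hull wing (- 1) n"
  "m < n \<Longrightarrow> wing_cell n (Suc m) = convex hull strip m"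
  by (simp_all add: wing_cell_def)

lemma wing_cell_meets:
  shows "meet_in {pt 1 0} (wing_cell n 0) (wing_cell n (Suc n))"
    and "m < n \<Longrightarrow> meet_in {pt 1 m, pt 1 (Suc m)} (wing_cell n 0) (wing_cell n (Suc m))"
    and "m < n \<Longrightarrow> meet_in {pt (- 1) m, pt (- 1) (Suc m)} (wing_cell n (Suc n)) (wing_cell n (Suc m))"
    and "m < m' \<Longrightarrow> m' < n \<Longrightarrow> meet_in (if m' = Suc m then {pt 1 m', pt (- 1) m'} else {})
      (wing_cell n (Suc m)) (wing_cell n (Suc m'))"
  using meet_wings[of n] meet_wing_strip[of 1 m n] meet_wing_strip[of "- 1" m n] meet_strips[of m m']
  by (simp_all add: wing_cell_simps)

lemma wing_cell_cases:
  assumes "k < l" "l < n + 2"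
  obtains "k = 0" "l = Suc n" | m where "m < n" "k = 0" "l = Suc m"
  | m where "m < n" "k = Suc m" "l = Suc n" | m m' where "m < m'" "m' < n" "k = Suc m" "l = Suc m'"
proof -
  obtain m' where l: "l = Suc m'" using assms(1) by (cases l) auto
  show ?thesis
  proof (cases k)
    case 0
    then show ?thesis using that(1,2) l assms by (cases "m' = n") auto
  next
    case (Suc m)
    then show ?thesis using that(3)[of m] that(4)[of m m'] l assms by (cases "m' = n") auto
  qed
qed

lemma card_pair_le_2: "card {p, q} \<le> 2"
  by (simp add: card_insert_if)

lemma shared_edge_if_meet_in:
  fixes p q :: "'a::euclidean_space"
  assumes "meet_in {p, q} \<sigma> \<sigma>'" "p \<noteq> q"
  shows "edges \<sigma> \<inter> edges \<sigma>' \<noteq> {}"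
  using shared_edge[of p q \<sigma> \<sigma>'] assms by (auto simp: meet_in_def)

lemma cell_complex_wing:
  assumes "2 \<le> n"
  shows "cell_complex (wing_cell n) (n + 2)"
proof
  have fin: "finite (wing s n)" "finite (strip m)" for s m by (simp_all add: wing_def strip_def)
  show "polytope (wing_cell n k)" for k
    unfolding wing_cell_def by (rule polytope_convex_hull) (simp add: fin)
  show "aff_dim (wing_cell n k) = 2" for k
    using wing_polygon_facts(1)[OF assms] strip_polygon_facts(1) by (simp add: wing_cell_def)
  fix k l assume kl: "k < l" "l < n + 2"
  show "\<exists>E. finite E \<and> card E \<le> 2 \<and> meet_in E (wing_cell n k) (wing_cell n l)"
    using kl
  proof (cases rule: wing_cell_cases)
    case 1
    then show ?thesis using wing_cell_meets(1)[of n] by (intro exI[of _ "{pt 1 0}"]) simp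
  next
    case (2 m)
    then show ?thesis using wing_cell_meets(2)[of m n] card_pair_le_2
      by (intro exI[of _ "{pt 1 m, pt 1 (Suc m)}"]) simp
  next
    case (3 m)
    then show ?thesis using meet_in_sym[OF wing_cell_meets(3)[of m n]] card_pair_le_2
      by (intro exI[of _ "{pt (- 1) m, pt (- 1) (Suc m)}"]) simp
  next
    case (4 m m')
    then show ?thesis using wing_cell_meets(4)[of m m' n] card_pair_le_2[of "pt 1 m'" "pt (- 1) m'"]
      by (intro exI[of _ "if m' = Suc m then {pt 1 m', pt (- 1) m'} else {}"]) auto
  qed
  have shared: "edges (wing_cell n 0) \<inter> edges (wing_cell n (Suc m)) \<noteq> {}"
    "edges (wing_cell n (Suc n)) \<inter> edges (wing_cell n (Suc m)) \<noteq> {}" if "m < n" for m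
    using shared_edge_if_meet_in[OF wing_cell_meets(2)[OF that]]
      shared_edge_if_meet_in[OF wing_cell_meets(3)[OF that]] by (simp_all add: pt_eq_iff)
  assume ne: "wing_cell n k \<inter> wing_cell n l \<noteq> {}"
  show "edges (wing_cell n k) \<inter> edges (wing_cell n l) \<noteq> {} \<or>
      (\<exists>m<n + 2. m \<noteq> k \<and> m \<noteq> l \<and> wing_cell n k \<inter> wing_cell n l \<subseteq> wing_cell n m \<and>
        edges (wing_cell n k) \<inter> edges (wing_cell n m) \<noteq> {} \<and>
        edges (wing_cell n m) \<inter> edges (wing_cell n l) \<noteq> {})"
    using kl
  proof (cases rule: wing_cell_cases)
    case 1
    have "wing_cell n k \<inter> wing_cell n l = {pt 1 0}"
      using wing_cell_meets(1)[of n] 1 by (simp add: meet_in_def)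
    moreover have "pt 1 0 \<in> wing_cell n (Suc 0)"
      using assms by (simp add: wing_cell_simps strip_def hull_inc)
    ultimately show ?thesis using 1 assms shared[of 0]
      by (intro disjI2 exI[of _ "Suc 0"]) (auto simp: Int_commute)
  next
    case (2 m)
    then show ?thesis using shared(1)[of m] by simp
  next
    case (3 m)
    then show ?thesis using shared(2)[of m] by (simp add: Int_commute)
  next
    case (4 m m')
    have "m' = Suc m"
      using ne wing_cell_meets(4)[of m m' n] 4 by (auto simp: meet_in_def split: if_splits)
    then have "edges (wing_cell n k) \<inter> edges (wing_cell n l) \<noteq> {}"
      using wing_cell_meets(4)[of m m' n] 4 by (intro shared_edge_if_meet_in) (auto simp: pt_eq_iff)
    then show ?thesis ..
  qed
qed

text \<open>The coefficients of the linear form that defines the edge between the \<open>m\<close>-th strip and the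
  wing \<open>s\<close>.\<close>

definition wing_line :: "real \<Rightarrow> nat \<Rightarrow> real^3" where
  "wing_line s m = vec3 (real m * (real m + 1)) s (- (2 * real m + 1))"

lemma wing_line_lift:
  assumes "s = 1 \<or> s = - 1" "j = m \<or> j = Suc m"
  shows "wing_line s m \<bullet> lift (pt s j) = 0"
  using assms(2) line_eq[OF assms(1), of j m] unfolding wing_line_def inner_vec3_lift
  by (auto simp: algebra_simps)

lemma wing_line_nonzero: "s \<noteq> 0 \<Longrightarrow> wing_line s m \<noteq> 0"
proof
  assume "s \<noteq> 0" "wing_line s m = 0"
  then have "wing_line s m $ 1 = 0" by simp
  then show False using \<open>s \<noteq> 0\<close> by (simp add: wing_line_def)
qed

text \<open>The zero of this form on the axis \<open>x = 0\<close>; it is the same for both wings.\<close>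

definition wing_root :: "nat \<Rightarrow> real" where
  "wing_root m = real m * (real m + 1) / (2 * real m + 1)"

lemma inj_wing_root: "inj wing_root"
proof (rule injI)
  fix m m' assume "wing_root m = wing_root m'"
  then have "real m * (real m + 1) * (2 * real m' + 1) = real m' * (real m' + 1) * (2 * real m + 1)"
    unfolding wing_root_def by (subst (asm) frac_eq_eq) (auto simp: add_nonneg_eq_0_iff)
  then have "(real m' - real m) * (2 * real m * real m' + real m + real m' + 1) = 0"
    by (simp add: algebra_simps)
  moreover have "2 * real m * real m' + real m + real m' + 1 > 0" by (simp add: add_nonneg_pos)
  ultimately show "m = m'" by simp
qed

lemma restr_wing_line:
  "restr (lin_form (wing_line s m)) = [:real m * (real m + 1), - (2 * real m + 1):]"
  by (simp add: restr_lin_form wing_line_def)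

lemma wing_root_dvd:
  assumes "lin_form (wing_line s m) ^ k dvd p"
  shows "[:- wing_root m, 1:] ^ k dvd restr p"
proof -
  have "[:real m * (real m + 1), - (2 * real m + 1):] ^ k dvd restr p"
    using restr_dvd[OF assms] unfolding restr_power restr_wing_line .
  then have "[:- (- (real m * (real m + 1)) / - (2 * real m + 1)), 1:] ^ k dvd restr p"
    by (rule linear_power_dvd) (simp add: add_nonneg_eq_0_iff)
  then show ?thesis by (simp only: minus_divide_divide wing_root_def)
qed

lemma wing_minimal_generator:
  assumes "2 \<le> n"
  defines "P \<equiv> cell_complex.complex (wing_cell n) (n + 2)"
  obtains F where "minimal_generator (splines r P) (int (n * (r + 1))) F" "supported_on_single_facet P F"
proof -
  interpret cell_complex "wing_cell n" "n + 2" by (rule cell_complex_wing[OF assms(1)])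
  define L where "L = (\<Prod>m<n. lin_form (wing_line 1 m) ^ (r + 1))"
  define F where "F = (\<lambda>\<rho>. if \<rho> = wing_cell n 0 then L else 0)"
  define \<Lambda> where "\<Lambda> G = G (wing_cell n 0) - G (wing_cell n (Suc n))" for G :: "(real^2) set \<Rightarrow> poly3"
  have "F \<in> splines r complex"
    unfolding F_def
  proof (rule single_facet_spline_cells)
    fix l assume l: "l < n + 2" "l \<noteq> 0"
    show "(\<exists>p. meet_in {p} (wing_cell n 0) (wing_cell n l)) \<or>
      (\<exists>p q c. meet_in {p, q} (wing_cell n 0) (wing_cell n l) \<and> c \<bullet> lift p = 0 \<and> c \<bullet> lift q = 0 \<and>
        lin_form c ^ (r + 1) dvd L)"
    proof (cases "l = Suc n")
      case True
      then show ?thesis using wing_cell_meets(1)[of n] by blast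
    next
      case False
      then obtain m where m: "l = Suc m" "m < n" using l by (cases l) auto
      have "lin_form (wing_line 1 m) ^ (r + 1) dvd L"
        unfolding L_def using m(2) by (intro dvd_prodI) auto
      then show ?thesis
        using wing_cell_meets(2)[OF m(2)] wing_line_lift[of 1 m m] wing_line_lift[of 1 "Suc m" m] m(1) by blast
    qed
  qed simp
  moreover have "tuple_deg (\<lambda>_. 0) (int (card (wing_root ` {..<n}) * (r + 1))) F"
  proof -
    have "homogeneous (int n * int (r + 1)) L"
      using homogeneous_prod[of "{..<n}" "int (r + 1)" "\<lambda>m. lin_form (wing_line 1 m) ^ (r + 1)"]
        homogeneous_power[OF homogeneous_lin_form, of "r + 1"] unfolding L_def by simp
    moreover have "card (wing_root ` {..<n}) = n"
      using inj_wing_root by (subst card_image) (auto intro: inj_on_subset)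
    ultimately show ?thesis by (simp add: tuple_deg_def F_def algebra_simps)
  qed
  moreover have "[:- x, 1:] ^ (r + 1) dvd restr (\<Lambda> G)"
    if G: "G \<in> splines r complex" and x: "x \<in> wing_root ` {..<n}" for G x
  proof -
    obtain m where m: "m < n" "x = wing_root m" using x by auto
    have d1: "lin_form (wing_line 1 m) ^ (r + 1) dvd G (wing_cell n 0) - G (wing_cell n (Suc m))"
      using m(1) by (intro spline_dvd_cells[OF G _ _ _ wing_cell_meets(2)[OF m(1)]])
        (simp_all add: pt_eq_iff wing_line_lift wing_line_nonzero)
    have d2: "lin_form (wing_line (- 1) m) ^ (r + 1) dvd G (wing_cell n (Suc n)) - G (wing_cell n (Suc m))"
      using m(1) by (intro spline_dvd_cells[OF G _ _ _ wing_cell_meets(3)[OF m(1)]])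
        (simp_all add: pt_eq_iff wing_line_lift wing_line_nonzero)
    show ?thesis
      using dvd_diff[OF wing_root_dvd[OF d1] wing_root_dvd[OF d2]] m(2) by (simp add: \<Lambda>_def restr_diff)
  qed
  moreover have "restr (\<Lambda> F) \<noteq> 0"
  proof -
    have "wing_cell n (Suc n) \<noteq> wing_cell n 0" using cell_neq[of "Suc n" 0] by simp
    then have "\<Lambda> F = L" by (simp add: \<Lambda>_def F_def)
    then have "restr (\<Lambda> F) = (\<Prod>m<n. [:real m * (real m + 1), - (2 * real m + 1):] ^ (r + 1))"
      by (simp only: L_def restr_prod restr_power restr_wing_line)
    moreover have "[:real m * (real m + 1), - (2 * real m + 1):] \<noteq> 0" for m
      by (simp add: add_nonneg_eq_0_iff)
    ultimately show ?thesis
      by (simp only: prod_zero_iff finite_lessThan power_eq_0_iff) blast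
  qed
  ultimately have "minimal_generator (splines r complex) (int (card (wing_root ` {..<n}) * (r + 1))) F"
    using assms(1)
    by (intro minimal_generator_if_restr[where \<Lambda> = \<Lambda>])
       (auto simp: \<Lambda>_def sum_fun_apply sum_subtractf right_diff_distrib tuple_deg_def homogeneous_diff
         lessThan_empty_iff)
  moreover have "card (wing_root ` {..<n}) = n"
    using inj_wing_root by (subst card_image) (auto intro: inj_on_subset)
  moreover have "supported_on_single_facet complex F"
    unfolding F_def by (rule supported_on_single_facet) simp
  ultimately show ?thesis using that unfolding P_def by metis
qed

lemma card_edges_wing_cell:
  assumes "2 \<le> n"
  shows "card (edges (wing_cell n k)) = (if k = 0 \<or> k = Suc n then n + 1 else if k = 1 then 3 else 4)"
  using wing_polygon_facts(2)[OF assms] strip_polygon_facts(2) by (simp add: wing_cell_def)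

lemma edge_counts_wing:
  assumes "2 \<le> n"
  shows "edge_counts (cell_complex.complex (wing_cell n) (n + 2))
    = {#3#} + replicate_mset (n - 1) 4 + replicate_mset 2 (n + 1)"
proof -
  interpret cell_complex "wing_cell n" "n + 2" by (rule cell_complex_wing[OF assms])
  have set: "{..<n + 2} = insert 0 (insert (Suc n) (insert 1 {2..n}))" using assms by auto
  have "image_mset (\<lambda>k. card (edges (wing_cell n k))) (mset_set {2..n}) = image_mset (\<lambda>_. 4) (mset_set {2..n})"
    by (rule image_mset_cong) (auto simp: card_edges_wing_cell[OF assms])
  then have "image_mset (\<lambda>k. card (edges (wing_cell n k))) (mset_set {2..n}) = replicate_mset (n - 1) 4"
    by (simp add: image_mset_const_eq)
  then show ?thesis
    unfolding edge_counts_complex set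
    using assms by (simp add: card_edges_wing_cell[OF assms] numeral_2_eq_2)
qed

lemma max_edges_wing:
  assumes "3 \<le> n"
  shows "max_edges (cell_complex.complex (wing_cell n) (n + 2)) = n + 1"
proof -
  have n: "2 \<le> n" using assms by simp
  interpret cell_complex "wing_cell n" "n + 2" by (rule cell_complex_wing[OF n])
  show ?thesis
    unfolding max_edges_complex card_edges_wing_cell[OF n]
    using assms by (intro Max_eqI) (auto split: if_splits intro!: image_eqI[of _ _ 0])
qed

section \<open>A square cut by its diagonals\<close>

text \<open>The square with vertices \<open>(0, \<plusminus>1)\<close> and \<open>(2, \<plusminus>1)\<close>, cut into four triangles: top, left, bottom and
  right. Its centre \<open>(1, 0)\<close> does not lie on the line \<open>x = 0\<close>, so the two diagonals
  meet that line in different points.\<close>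

definition square_triangle :: "nat \<Rightarrow> (real^2) set" where
  "square_triangle k = set (
     if k = 0 then [vector [1, 0], vector [2, 1], vector [0, 1]]
     else if k = 1 then [vector [1, 0], vector [0, 1], vector [0, - 1]]
     else if k = 2 then [vector [1, 0], vector [0, - 1], vector [2, - 1]]
     else [vector [1, 0], vector [2, - 1], vector [2, 1]])"

definition square_cell :: "nat \<Rightarrow> (real^2) set" where
  "square_cell k = convex hull square_triangle k"

lemma square_cell_facts: "aff_dim (square_cell k) = 2" "card (edges (square_cell k)) = 3"
proof -
  have "aff_dim (square_cell k) = 2 \<and> card (edges (square_cell k)) = 3"
  proof -
    obtain p q t :: "real^2" where "square_triangle k = set [p, q, t]" "0 < orient p q t"
    proof -
      consider "k = 0" | "k = 1" | "k = 2" | "k > 2" by linarith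
      then show thesis
      proof cases
        case 1
        show thesis by (rule that[of "vector [1, 0]" "vector [2, 1]" "vector [0, 1]"])
            (simp_all add: 1 square_triangle_def orient_def)
      next
        case 2
        show thesis by (rule that[of "vector [1, 0]" "vector [0, 1]" "vector [0, - 1]"])
            (simp_all add: 2 square_triangle_def orient_def)
      next
        case 3
        show thesis by (rule that[of "vector [1, 0]" "vector [0, - 1]" "vector [2, - 1]"])
            (simp_all add: 3 square_triangle_def orient_def)
      next
        case 4
        show thesis by (rule that[of "vector [1, 0]" "vector [2, - 1]" "vector [2, 1]"])
            (use 4 in \<open>simp_all add: square_triangle_def orient_def\<close>)
      qed
    qed
    then show ?thesis using polygon_of_list[OF polygon_3, of p q t] by (simp add: square_cell_def)
  qed
  then show "aff_dim (square_cell k) = 2" "card (edges (square_cell k)) = 3" by simp_all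
qed

lemma square_meets:
  shows "meet_in {vector [1, 0], vector [0, 1]} (square_cell 1) (square_cell 0)"
    and "meet_in {vector [1, 0], vector [0, - 1]} (square_cell 1) (square_cell 2)"
    and "meet_in {vector [1, 0], vector [2, - 1]} (square_cell 2) (square_cell 3)"
    and "meet_in {vector [1, 0], vector [2, 1]} (square_cell 0) (square_cell 3)"
    and "meet_in {vector [1, 0]} (square_cell 2) (square_cell 0)"
    and "meet_in {vector [1, 0]} (square_cell 1) (square_cell 3)"
proof -
  show "meet_in {vector [1, 0], vector [0, 1]} (square_cell 1) (square_cell 0)"
    unfolding square_cell_def
    by (rule meet_in_if_separated[of _ _ "vector [1, 1]" 1]) (auto simp: square_triangle_def inner_vector2)
  show "meet_in {vector [1, 0], vector [0, - 1]} (square_cell 1) (square_cell 2)"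
    unfolding square_cell_def
    by (rule meet_in_if_separated[of _ _ "vector [1, - 1]" 1]) (auto simp: square_triangle_def inner_vector2)
  show "meet_in {vector [1, 0], vector [2, - 1]} (square_cell 2) (square_cell 3)"
    unfolding square_cell_def
    by (rule meet_in_if_separated[of _ _ "vector [1, 1]" 1]) (auto simp: square_triangle_def inner_vector2)
  show "meet_in {vector [1, 0], vector [2, 1]} (square_cell 0) (square_cell 3)"
    unfolding square_cell_def
    by (rule meet_in_if_separated[of _ _ "vector [1, - 1]" 1]) (auto simp: square_triangle_def inner_vector2)
  show "meet_in {vector [1, 0]} (square_cell 2) (square_cell 0)"
    unfolding square_cell_def
    by (rule meet_in_if_separated[of _ _ "vector [0, 1]" 0]) (auto simp: square_triangle_def inner_vector2)
  show "meet_in {vector [1, 0]} (square_cell 1) (square_cell 3)"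
    unfolding square_cell_def
    by (rule meet_in_if_separated[of _ _ "vector [1, 0]" 1]) (auto simp: square_triangle_def inner_vector2)
qed

lemma cell_complex_square: "cell_complex square_cell 4"
proof
  show "polytope (square_cell k)" for k
    unfolding square_cell_def by (rule polytope_convex_hull) (simp add: square_triangle_def)
  show "aff_dim (square_cell k) = 2" for k by (rule square_cell_facts)
  fix k l :: nat assume "k < l" "l < 4"
  then consider "k = 0" "l = 1" | "k = 1" "l = 2" | "k = 2" "l = 3" | "k = 0" "l = 3" | "k = 0" "l = 2" | "k = 1" "l = 3"
    by linarith
  note cases = this
  have neq: "(vector [a, b] :: real^2) = vector [c, d] \<longleftrightarrow> a = c \<and> b = d" for a b c d :: real
    by (auto simp: vec_eq_iff forall_2)
  show "\<exists>E. finite E \<and> card E \<le> 2 \<and> meet_in E (square_cell k) (square_cell l)"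
    by (rule cases; hypsubst; rule exI; intro conjI;
      (rule square_meets meet_in_sym[OF square_meets(1)] meet_in_sym[OF square_meets(5)])?;
      simp add: card_pair_le_2)
  have shared: "edges (square_cell 0) \<inter> edges (square_cell 1) \<noteq> {}" "edges (square_cell 1) \<inter> edges (square_cell 2) \<noteq> {}"
    "edges (square_cell 2) \<inter> edges (square_cell 3) \<noteq> {}" "edges (square_cell 0) \<inter> edges (square_cell 3) \<noteq> {}"
    using shared_edge_if_meet_in[OF square_meets(1)] shared_edge_if_meet_in[OF square_meets(2)]
      shared_edge_if_meet_in[OF square_meets(3)] shared_edge_if_meet_in[OF square_meets(4)]
    by (simp_all add: neq Int_commute)
  have c: "vector [1, 0] \<in> square_cell m" for m
    by (auto simp: square_cell_def square_triangle_def intro!: hull_inc)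
  show "edges (square_cell k) \<inter> edges (square_cell l) \<noteq> {} \<or>
      (\<exists>m<4. m \<noteq> k \<and> m \<noteq> l \<and> square_cell k \<inter> square_cell l \<subseteq> square_cell m \<and>
        edges (square_cell k) \<inter> edges (square_cell m) \<noteq> {} \<and>
        edges (square_cell m) \<inter> edges (square_cell l) \<noteq> {})"
  proof (rule cases)
    assume "k = 0" "l = 2"
    moreover have "square_cell 0 \<inter> square_cell 2 = {vector [1, 0]}"
      using square_meets(5) by (simp add: meet_in_def Int_commute)
    then have "square_cell 0 \<inter> square_cell 2 \<subseteq> square_cell 1" using c[of 1] by simp
    ultimately show ?thesis using shared by (intro disjI2 exI[of _ 1]) simp
  next
    assume "k = 1" "l = 3"
    moreover have "square_cell 1 \<inter> square_cell 3 = {vector [1, 0]}"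
      using square_meets(6) by (simp add: meet_in_def Int_commute)
    then have "square_cell 1 \<inter> square_cell 3 \<subseteq> square_cell 2" using c[of 2] by simp
    ultimately show ?thesis using shared by (intro disjI2 exI[of _ 2]) simp
  qed (use shared in simp_all)
qed

lemma max_edges_square: "max_edges (cell_complex.complex square_cell 4) = 3"
proof -
  interpret cell_complex square_cell 4 by (rule cell_complex_square)
  have "(\<lambda>k. card (edges (square_cell k))) ` {..<4} = {3}"
    unfolding square_cell_facts by (auto simp: image_constant_conv lessThan_empty_iff)
  then show ?thesis by (simp add: max_edges_complex)
qed

lemma square_minimal_generator:
  defines "P \<equiv> cell_complex.complex square_cell 4"
  obtains F where "minimal_generator (splines r P) (int (2 * (r + 1))) F"
proof -
  interpret cell_complex square_cell 4 by (rule cell_complex_square)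
  \<comment> \<open>\<open>\<alpha>\<close> and \<open>\<beta>\<close> define the diagonals \<open>x + y = 1\<close> and \<open>x - y = 1\<close>\<close>
  define \<alpha> where "\<alpha> = vec3 (- 1) 1 1"
  define \<beta> where "\<beta> = vec3 (- 1) 1 (- 1)"
  have nz: "\<alpha> \<noteq> 0" "\<beta> \<noteq> 0"
    using vec3_nth(2)[of "- 1" 1] by (metis \<alpha>_def \<beta>_def zero_index zero_neq_one)+
  have restr: "restr (lin_form \<alpha>) = [:- 1, 1:]" "restr (lin_form \<beta>) = [:- 1, - 1:]"
    by (simp_all add: restr_lin_form \<alpha>_def \<beta>_def)
  have neq: "(vector [a, b] :: real^2) = vector [c, d] \<longleftrightarrow> a = c \<and> b = d" for a b c d :: real
    by (auto simp: vec_eq_iff forall_2)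
  have \<alpha>_lift: "\<alpha> \<bullet> lift (vector [1, 0]) = 0" "\<alpha> \<bullet> lift (vector [0, 1]) = 0" "\<alpha> \<bullet> lift (vector [2, - 1]) = 0"
    and \<beta>_lift: "\<beta> \<bullet> lift (vector [1, 0]) = 0" "\<beta> \<bullet> lift (vector [0, - 1]) = 0" "\<beta> \<bullet> lift (vector [2, 1]) = 0"
    by (simp_all add: \<alpha>_def \<beta>_def inner_vec3_lift)
  define L where "L = lin_form \<alpha> ^ (r + 1) * lin_form \<beta> ^ (r + 1)"
  have \<alpha>L: "lin_form \<alpha> ^ (r + 1) dvd L" and \<beta>L: "lin_form \<beta> ^ (r + 1) dvd L"
    unfolding L_def by (rule dvd_triv_left dvd_triv_right)+
  define F where "F = (\<lambda>\<rho>. if \<rho> = square_cell 0 then L else 0)"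
  define \<Lambda> where "\<Lambda> G = (G (square_cell 0) - G (square_cell 1)) + (G (square_cell 2) - G (square_cell 3))"
    for G :: "(real^2) set \<Rightarrow> poly3"
  have "F \<in> splines r complex"
    unfolding F_def
  proof (rule single_facet_spline_cells)
    fix l :: nat assume "l < 4" "l \<noteq> 0"
    then consider "l = 1" | "l = 2" | "l = 3" by linarith
    then show "(\<exists>p. meet_in {p} (square_cell 0) (square_cell l)) \<or>
      (\<exists>p q c. meet_in {p, q} (square_cell 0) (square_cell l) \<and> c \<bullet> lift p = 0 \<and> c \<bullet> lift q = 0 \<and>
        lin_form c ^ (r + 1) dvd L)"
    proof cases
      case 1
      then show ?thesis using \<alpha>_lift(1,2) meet_in_sym[OF square_meets(1)] \<alpha>L by blast
    next
      case 2
      then show ?thesis using meet_in_sym[OF square_meets(5)] by blast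
    next
      case 3
      then show ?thesis using \<beta>_lift(1,3) square_meets(4) \<beta>L by blast
    qed
  qed simp
  moreover have card: "card {1, - 1 :: real} = 2" by simp
  moreover have "tuple_deg (\<lambda>_. 0) (int (card {1, - 1 :: real} * (r + 1))) F"
  proof -
    have "homogeneous (int (r + 1)) (lin_form c ^ (r + 1))" for c
      using homogeneous_power[OF homogeneous_lin_form, of "r + 1" c] by simp
    from homogeneous_mult[OF this[of \<alpha>] this[of \<beta>]] show ?thesis
      unfolding card by (simp add: tuple_deg_def F_def L_def algebra_simps)
  qed
  moreover have "[:- x, 1:] ^ (r + 1) dvd restr (\<Lambda> G)"
    if G: "G \<in> splines r complex" and x: "x \<in> {1, - 1}" for G x
  proof -
    let ?c = square_cell
    have "lin_form \<alpha> ^ (r + 1) dvd G (?c 1) - G (?c 0)"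
      by (rule spline_dvd_cells[OF G _ _ _ square_meets(1) _ \<alpha>_lift(1,2) nz(1)]) (simp_all add: neq)
    moreover have "lin_form \<alpha> ^ (r + 1) dvd G (?c 2) - G (?c 3)"
      by (rule spline_dvd_cells[OF G _ _ _ square_meets(3) _ \<alpha>_lift(1,3) nz(1)]) (simp_all add: neq)
    ultimately have \<alpha>: "lin_form \<alpha> ^ (r + 1) dvd (G (?c 2) - G (?c 3)) - (G (?c 1) - G (?c 0))"
      by (rule dvd_diff[rotated])
    have "lin_form \<beta> ^ (r + 1) dvd G (?c 1) - G (?c 2)"
      by (rule spline_dvd_cells[OF G _ _ _ square_meets(2) _ \<beta>_lift(1,2) nz(2)]) (simp_all add: neq)
    moreover have "lin_form \<beta> ^ (r + 1) dvd G (?c 0) - G (?c 3)"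
      by (rule spline_dvd_cells[OF G _ _ _ square_meets(4) _ \<beta>_lift(1,3) nz(2)]) (simp_all add: neq)
    ultimately have \<beta>: "lin_form \<beta> ^ (r + 1) dvd (G (?c 0) - G (?c 3)) - (G (?c 1) - G (?c 2))"
      by (rule dvd_diff[rotated])
    have "(G (?c 2) - G (?c 3)) - (G (?c 1) - G (?c 0)) = \<Lambda> G"
      "(G (?c 0) - G (?c 3)) - (G (?c 1) - G (?c 2)) = \<Lambda> G"
      by (simp_all add: \<Lambda>_def)
    then have "lin_form \<alpha> ^ (r + 1) dvd \<Lambda> G" "lin_form \<beta> ^ (r + 1) dvd \<Lambda> G" using \<alpha> \<beta> by simp_all
    then have "[:- 1, 1:] ^ (r + 1) dvd restr (\<Lambda> G)" "[:- 1, - 1:] ^ (r + 1) dvd restr (\<Lambda> G)"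
      using restr_dvd restr restr_power by metis+
    moreover from linear_power_dvd[OF this(2)] have "[:- (- 1), 1:] ^ (r + 1) dvd restr (\<Lambda> G)" by simp
    ultimately show ?thesis using x by blast
  qed
  moreover have "restr (\<Lambda> F) \<noteq> 0"
  proof -
    have "square_cell k \<noteq> square_cell 0" if "k < 4" "k \<noteq> 0" for k using cell_neq[of k 0] that by simp
    then have "\<Lambda> F = L" by (simp add: \<Lambda>_def F_def)
    then have eq: "restr (\<Lambda> F) = [:- 1, 1:] ^ (r + 1) * [:- 1, - 1:] ^ (r + 1)"
      by (simp only: L_def restr_mult restr_power restr)
    show ?thesis unfolding eq by (intro no_zero_divisors power_not_zero) simp_all
  qed
  ultimately have "minimal_generator (splines r complex) (int (card {1, - 1 :: real} * (r + 1))) F"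
    by (intro minimal_generator_if_restr[where \<Lambda> = \<Lambda>])
       (auto simp: \<Lambda>_def sum_fun_apply sum_subtractf sum.distrib right_diff_distrib distrib_left
         tuple_deg_def homogeneous_diff homogeneous_add)
  then show ?thesis using that unfolding P_def card by blast
qed

section \<open>Sharpness of the regularity bound\<close>

theorem theorem5p7:
  fixes n r :: nat
  assumes "n \<ge> 2"
  shows "(\<exists>P :: (real^2) set set.
            polytopal_complex P \<and> pure_2dim P \<and> hereditary P \<and>
            edge_counts P = {#3#} + replicate_mset (n - 1) 4 + replicate_mset 2 (n + 1) \<and>
            (\<exists>F. minimal_generator (splines r P) (int (n * (r + 1))) F \<and>
                 supported_on_single_facet P F) \<and>
            reg (splines r P) \<ge> ereal (real (n * (r + 1))))
       \<and> (\<forall>B :: nat \<Rightarrow> ereal.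
            (\<forall>Q :: (real^2) set set.
               polytopal_complex Q \<and> pure_2dim Q \<and> hereditary Q \<longrightarrow>
               reg (splines r Q) \<le> B (max_edges Q)) \<longrightarrow>
            (\<forall>F\<ge>3. ereal (real ((F - 1) * (r + 1))) \<le> B F))"
proof (intro conjI allI impI)
  show "\<exists>P :: (real^2) set set. polytopal_complex P \<and> pure_2dim P \<and> hereditary P \<and>
      edge_counts P = {#3#} + replicate_mset (n - 1) 4 + replicate_mset 2 (n + 1) \<and>
      (\<exists>F. minimal_generator (splines r P) (int (n * (r + 1))) F \<and> supported_on_single_facet P F) \<and>
      reg (splines r P) \<ge> ereal (real (n * (r + 1)))"
  proof -
    interpret cell_complex "wing_cell n" "n + 2" by (rule cell_complex_wing[OF assms])
    obtain F where F: "minimal_generator (splines r complex) (int (n * (r + 1))) F"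
      "supported_on_single_facet complex F"
      by (rule wing_minimal_generator[OF assms])
    show ?thesis
      using polytopal_complex pure_2dim hereditary edge_counts_wing[OF assms] F reg_splines_ge[OF F(1)]
      by (intro exI[of _ complex]) blast
  qed
  fix B :: "nat \<Rightarrow> ereal" and F :: nat
  assume B: "\<forall>Q :: (real^2) set set. polytopal_complex Q \<and> pure_2dim Q \<and> hereditary Q \<longrightarrow>
      reg (splines r Q) \<le> B (max_edges Q)" and "3 \<le> F"
  show "ereal (real ((F - 1) * (r + 1))) \<le> B F"
    \<comment> \<open>the wing complex with two strips has a face with four edges, so \<open>F = 3\<close> needs the square\<close>
  proof (cases "F = 3")
    case True
    interpret cell_complex square_cell 4 by (rule cell_complex_square)
    obtain G where "minimal_generator (splines r complex) (int (2 * (r + 1))) G"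
      by (rule square_minimal_generator)
    then have "ereal (real (2 * (r + 1))) \<le> reg (splines r complex)" by (rule reg_splines_ge)
    also have "\<dots> \<le> B (max_edges complex)" using B polytopal_complex pure_2dim hereditary by blast
    finally show ?thesis using True by (simp add: max_edges_square)
  next
    case False
    define k where "k = F - 1"
    have k: "2 \<le> k" "3 \<le> k" "F = k + 1" using False \<open>3 \<le> F\<close> by (auto simp: k_def)
    interpret cell_complex "wing_cell k" "k + 2" by (rule cell_complex_wing[OF k(1)])
    obtain G where "minimal_generator (splines r complex) (int (k * (r + 1))) G"
      by (rule wing_minimal_generator[OF k(1)])
    then have "ereal (real (k * (r + 1))) \<le> reg (splines r complex)" by (rule reg_splines_ge)
    also have "\<dots> \<le> B (max_edges complex)" using B polytopal_complex pure_2dim hereditary by blast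
    also have "max_edges complex = F" using max_edges_wing[OF k(2)] k(3) by simp
    finally show ?thesis by (simp add: k_def)
  qed
qed

end
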